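(* Let $(M,\varphi,\xi,\eta,g)$ be a Kenmotsu pseudo-metric manifold of dimension $2n+1$ with $g(\xi,\xi)=\varepsilon\in\{1,-1\}$. If $(g,V)$ is a Ricci soliton with soliton constant $\lambda$, then $\lambda=2n\varepsilon$; hence the soliton is expanding or shrinking depending on the causal character of $\xi$ (expanding if $\varepsilon=1$, shrinking if $\varepsilon=-1$).
   Context: Let $M$ be a smooth manifold of dimension $2n+1$, $n\ge 1$. An almost contact pseudo-metric structure $(\varphi,\xi,\eta,g)$ on $M$ consists of a $(1,1)$-tensor field $\varphi$, a vector field $\xi$, a 1-form $\eta$ and a pseudo-Riemannian metric $g$ such that $\varphi^2=-I+\eta\otimes\xi$, $\eta(\xi)=1$, $\varphi\xi=0$, $\eta\circ\varphi=0$, and $g(\varphi X,\varphi Y)=g(X,Y)-\varepsilon\eta(X)\eta(Y)$ for all vector fields $X,Y$, where $\varepsilon=\pm1$; consequently $\eta(X)=\varepsilon g(X,\xi)$, $g(\varphi X,Y)=-g(X,\varphi Y)$ and $g(\xi,\xi)=\varepsilon$. It is a Kenmotsu pseudo-metric manifold if $(\nabla_X\varphi)Y=-\eta(Y)\varphi X-\varepsilon g(X,\varphi Y)\xi$ for all $X,Y$, where $\nabla$ is the Levi-Civita connection of $g$. Curvature: $R(X,Y)=[\nabla_X,\nabla_Y]-\nabla_{[X,Y]}$; $Ric(Y,Z)$ is the trace of $X\mapsto R(X,Y)Z$. For a vector field $V$ on $M$, $(g,V)$ is a Ricci soliton with soliton constant $\lambda\in\mathbb{R}$ if $(\pounds_Vg)(X,Y)+2Ric(X,Y)+2\lambda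 g(X,Y)=0$ for all $X,Y$, where $\pounds$ is the Lie derivative. It is steady if $\lambda=0$, expanding if $\lambda>0$, shrinking if $\lambda<0$. *)

theory Defs
  imports "HOL-Analysis.Analysis" "HOL-Library.Function_Algebras"
begin

instantiation "fun" :: (type, real_vector) real_vector
begin

definition scaleR_fun :: "real \<Rightarrow> ('a \<Rightarrow> 'b) \<Rightarrow> 'a \<Rightarrow> 'b" where
  "scaleR_fun r f = (\<lambda>x. r *\<^sub>R f x)"

instance
  by standard (auto simp: scaleR_fun_def fun_eq_iff algebra_simps)

end

definition linear_on_set :: "'v::real_vector set \<Rightarrow> ('v \<Rightarrow> 'w::real_vector) \<Rightarrow> bool" where
  "linear_on_set S T \<longleftrightarrow>
     (\<forall>u\<in>S. \<forall>v\<in>S. T (u + v) = T u + T v) \<and> (\<forall>r. \<forall>u\<in>S. T (r *\<^sub>R u) = r *\<^sub>R T u)"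

text \<open>
  The trace of a linear endomorphism \<open>T\<close> of a finite-dimensional subspace \<open>S\<close>; it does not
  depend on the basis that is chosen.
\<close>

definition trace_on :: "'v::real_vector set \<Rightarrow> ('v \<Rightarrow> 'v) \<Rightarrow> real" where
  "trace_on S T =
     (let B = (SOME B. B \<subseteq> S \<and> independent B \<and> S \<subseteq> span B)
      in \<Sum>b\<in>B. representation B (T b) b)"

text \<open>The two predicates below are used on open sets \<open>S\<close> only.\<close>

primrec Ck_on :: "nat \<Rightarrow> 'e::real_normed_vector set \<Rightarrow> ('e \<Rightarrow> 'b::real_normed_vector) \<Rightarrow> bool" where
  "Ck_on 0 S f \<longleftrightarrow> continuous_on S f"
| "Ck_on (Suc k) S f \<longleftrightarrow>
     (\<forall>x\<in>S. f differentiable (at x)) \<and> (\<forall>v. Ck_on k S (\<lambda>x. frechet_derivative f (at x) v))"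

definition smooth_on :: "'e::real_normed_vector set \<Rightarrow> ('e \<Rightarrow> 'b::real_normed_vector) \<Rightarrow> bool" where
  "smooth_on S f \<longleftrightarrow> (\<forall>k. Ck_on k S f)"

type_synonym ('a, 'e) chart = "'a set \<times> ('a \<Rightarrow> 'e)"

definition is_chart :: "('a::topological_space, 'e::euclidean_space) chart \<Rightarrow> bool" where
  "is_chart = (\<lambda>(U, x). open U \<and> open (x ` U) \<and> (\<exists>y. homeomorphism U (x ` U) x y))"

text \<open>
  The manifold is the whole type \<open>'a\<close>; the theorems restrict \<open>'a\<close> to Hausdorff second countable
  types. The dimension of the manifold is \<open>DIM('e)\<close>. The atlas need not be maximal.
\<close>

definition smooth_atlas :: "('a::topological_space, 'e::euclidean_space) chart set \<Rightarrow> bool" where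
  "smooth_atlas A \<longleftrightarrow>
     (\<forall>c\<in>A. is_chart c) \<and> (\<Union>c\<in>A. fst c) = UNIV \<and>
     (\<forall>(U, x)\<in>A. \<forall>(V, y)\<in>A. smooth_on (x ` (U \<inter> V)) (y \<circ> inv_into U x))"

definition smooth_functions ::
    "('a::topological_space, 'e::euclidean_space) chart set \<Rightarrow> ('a \<Rightarrow> real) set" where
  "smooth_functions A = {f. \<forall>(U, x)\<in>A. smooth_on (x ` U) (f \<circ> inv_into U x)}"

text \<open>
  Tangent vectors at \<open>p\<close> are the derivations at \<open>p\<close> of the algebra of smooth functions. They are
  set to \<open>0\<close> on non-smooth functions, so that equality of tangent vectors is equality in HOL.
\<close>

type_synonym 'a tangent = "('a \<Rightarrow> real) \<Rightarrow> real"
type_synonym 'a vfield = "'a \<Rightarrow> 'a tangent"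

definition tangent_space ::
    "('a::topological_space, 'e::euclidean_space) chart set \<Rightarrow> 'a \<Rightarrow> 'a tangent set" where
  "tangent_space A p =
     {v. linear_on_set (smooth_functions A) v \<and>
         (\<forall>f\<in>smooth_functions A. \<forall>h\<in>smooth_functions A. v (f * h) = v f * h p + f p * v h) \<and>
         (\<forall>f. f \<notin> smooth_functions A \<longrightarrow> v f = 0)}"

definition vector_fields ::
    "('a::topological_space, 'e::euclidean_space) chart set \<Rightarrow> 'a vfield set" where
  "vector_fields A =
     {X. (\<forall>p. X p \<in> tangent_space A p) \<and>
         (\<forall>f\<in>smooth_functions A. (\<lambda>p. X p f) \<in> smooth_functions A)}"

definition dir_deriv :: "'a vfield \<Rightarrow> ('a \<Rightarrow> real) \<Rightarrow> 'a \<Rightarrow> real" where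
  "dir_deriv X f = (\<lambda>p. X p f)"

definition fmul :: "('a \<Rightarrow> real) \<Rightarrow> 'a vfield \<Rightarrow> 'a vfield" where
  "fmul f X = (\<lambda>p. f p *\<^sub>R X p)"

definition lie_bracket ::
    "('a::topological_space, 'e::euclidean_space) chart set \<Rightarrow> 'a vfield \<Rightarrow> 'a vfield \<Rightarrow> 'a vfield" where
  "lie_bracket A X Y = (\<lambda>p f. if f \<in> smooth_functions A
     then X p (dir_deriv Y f) - Y p (dir_deriv X f) else 0)"

text \<open>
  Tensor fields are families of (multi)linear maps on the tangent spaces, with no constraint on
  their values outside the tangent spaces. They are smooth when they send smooth vector fields to
  smooth objects.
\<close>

type_synonym 'a one_form = "'a \<Rightarrow> 'a tangent \<Rightarrow> real"
type_synonym 'a endo_field = "'a \<Rightarrow> 'a tangent \<Rightarrow> 'a tangent"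
type_synonym 'a bilinear_field = "'a \<Rightarrow> 'a tangent \<Rightarrow> 'a tangent \<Rightarrow> real"

definition app :: "('a \<Rightarrow> 'a tangent \<Rightarrow> 'b) \<Rightarrow> 'a vfield \<Rightarrow> 'a \<Rightarrow> 'b" where
  "app t X = (\<lambda>p. t p (X p))"

definition app2 :: "'a bilinear_field \<Rightarrow> 'a vfield \<Rightarrow> 'a vfield \<Rightarrow> 'a \<Rightarrow> real" where
  "app2 g X Y = (\<lambda>p. g p (X p) (Y p))"

definition one_forms ::
    "('a::topological_space, 'e::euclidean_space) chart set \<Rightarrow> 'a one_form set" where
  "one_forms A =
     {\<eta>. (\<forall>p. linear_on_set (tangent_space A p) (\<eta> p)) \<and>
         (\<forall>X\<in>vector_fields A. app \<eta> X \<in> smooth_functions A)}"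

definition endo_fields ::
    "('a::topological_space, 'e::euclidean_space) chart set \<Rightarrow> 'a endo_field set" where
  "endo_fields A =
     {\<phi>. (\<forall>p. \<phi> p ` tangent_space A p \<subseteq> tangent_space A p \<and>
              linear_on_set (tangent_space A p) (\<phi> p)) \<and>
         (\<forall>X\<in>vector_fields A. app \<phi> X \<in> vector_fields A)}"

text \<open>
  Linearity in the first argument follows from symmetry. The index is not prescribed; it is
  automatically constant on connected components.
\<close>

definition pseudo_riemannian_metric ::
    "('a::topological_space, 'e::euclidean_space) chart set \<Rightarrow> 'a bilinear_field \<Rightarrow> bool" where
  "pseudo_riemannian_metric A g \<longleftrightarrow>
     (\<forall>p. (\<forall>v\<in>tangent_space A p. linear_on_set (tangent_space A p) (g p v)) \<and>
          (\<forall>v\<in>tangent_space A p. \<forall>w\<in>tangent_space A p. g p v w = g p w v) \<and>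
          (\<forall>v\<in>tangent_space A p. (\<forall>w\<in>tangent_space A p. g p v w = 0) \<longrightarrow> v = 0)) \<and>
     (\<forall>X\<in>vector_fields A. \<forall>Y\<in>vector_fields A. app2 g X Y \<in> smooth_functions A)"

text \<open>The Lie derivative as a tensor derivation: it is fixed on functions and on vector fields by
  \<open>V f\<close> and \<open>[V, X]\<close>, and on \<open>g\<close> by the Leibniz rule.\<close>

definition lie_deriv_metric ::
    "('a::topological_space, 'e::euclidean_space) chart set \<Rightarrow> 'a vfield \<Rightarrow> 'a bilinear_field \<Rightarrow>
     'a vfield \<Rightarrow> 'a vfield \<Rightarrow> 'a \<Rightarrow> real" where
  "lie_deriv_metric A V g X Y =
     dir_deriv V (app2 g X Y) - app2 g (lie_bracket A V X) Y - app2 g X (lie_bracket A V Y)"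

type_synonym 'a connection = "'a vfield \<Rightarrow> 'a vfield \<Rightarrow> 'a vfield"

definition affine_connection ::
    "('a::topological_space, 'e::euclidean_space) chart set \<Rightarrow> 'a connection \<Rightarrow> bool" where
  "affine_connection A D \<longleftrightarrow>
     (\<forall>X\<in>vector_fields A. \<forall>Y\<in>vector_fields A. D X Y \<in> vector_fields A) \<and>
     (\<forall>X\<in>vector_fields A. \<forall>Y\<in>vector_fields A. \<forall>Z\<in>vector_fields A.
        D (X + Y) Z = D X Z + D Y Z \<and> D X (Y + Z) = D X Y + D X Z) \<and>
     (\<forall>f\<in>smooth_functions A. \<forall>X\<in>vector_fields A. \<forall>Y\<in>vector_fields A.
        D (fmul f X) Y = fmul f (D X Y) \<and>
        D X (fmul f Y) = fmul (dir_deriv X f) Y + fmul f (D X Y))"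

definition levi_civita_connection ::
    "('a::topological_space, 'e::euclidean_space) chart set \<Rightarrow> 'a bilinear_field \<Rightarrow>
     'a connection \<Rightarrow> bool" where
  "levi_civita_connection A g D \<longleftrightarrow>
     affine_connection A D \<and>
     (\<forall>X\<in>vector_fields A. \<forall>Y\<in>vector_fields A. D X Y - D Y X = lie_bracket A X Y) \<and>
     (\<forall>X\<in>vector_fields A. \<forall>Y\<in>vector_fields A. \<forall>Z\<in>vector_fields A.
        dir_deriv X (app2 g Y Z) = app2 g (D X Y) Z + app2 g Y (D X Z))"

definition curvature ::
    "('a::topological_space, 'e::euclidean_space) chart set \<Rightarrow> 'a connection \<Rightarrow>
     'a vfield \<Rightarrow> 'a vfield \<Rightarrow> 'a vfield \<Rightarrow> 'a vfield" where
  "curvature A D X Y Z = D X (D Y Z) - D Y (D X Z) - D (lie_bracket A X Y) Z"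

text \<open>
  At a point \<open>p\<close>, the map whose trace is taken sends a tangent vector \<open>v\<close> to the value at \<open>p\<close> of
  \<open>R(X,Y)Z\<close>, where \<open>X\<close> is a vector field with \<open>X p = v\<close>. Such an \<open>X\<close> exists, and its choice does
  not matter because \<open>R\<close> is a tensor.
\<close>

definition ricci ::
    "('a::topological_space, 'e::euclidean_space) chart set \<Rightarrow> 'a connection \<Rightarrow>
     'a vfield \<Rightarrow> 'a vfield \<Rightarrow> 'a \<Rightarrow> real" where
  "ricci A D Y Z = (\<lambda>p. trace_on (tangent_space A p)
     (\<lambda>v. curvature A D (SOME X. X \<in> vector_fields A \<and> X p = v) Y Z p))"

definition cov_deriv_endo :: "'a connection \<Rightarrow> 'a endo_field \<Rightarrow> 'a vfield \<Rightarrow> 'a vfield \<Rightarrow> 'a vfield" where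
  "cov_deriv_endo D \<phi> X Y = D X (app \<phi> Y) - app \<phi> (D X Y)"

definition almost_contact_pseudo_metric ::
    "('a::topological_space, 'e::euclidean_space) chart set \<Rightarrow> 'a endo_field \<Rightarrow> 'a vfield \<Rightarrow>
     'a one_form \<Rightarrow> 'a bilinear_field \<Rightarrow> real \<Rightarrow> bool" where
  "almost_contact_pseudo_metric A \<phi> \<xi> \<eta> g \<epsilon> \<longleftrightarrow>
     \<phi> \<in> endo_fields A \<and> \<xi> \<in> vector_fields A \<and> \<eta> \<in> one_forms A \<and>
     pseudo_riemannian_metric A g \<and> \<epsilon> \<in> {1, -1} \<and>
     (\<forall>X\<in>vector_fields A. app \<phi> (app \<phi> X) = - X + fmul (app \<eta> X) \<xi>) \<and>
     app \<eta> \<xi> = 1 \<and>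
     app \<phi> \<xi> = 0 \<and>
     (\<forall>X\<in>vector_fields A. app \<eta> (app \<phi> X) = 0) \<and>
     (\<forall>X\<in>vector_fields A. \<forall>Y\<in>vector_fields A.
        app2 g (app \<phi> X) (app \<phi> Y) = app2 g X Y - \<epsilon> *\<^sub>R (app \<eta> X * app \<eta> Y))"

definition kenmotsu_pseudo_metric ::
    "('a::topological_space, 'e::euclidean_space) chart set \<Rightarrow> 'a connection \<Rightarrow> 'a endo_field \<Rightarrow>
     'a vfield \<Rightarrow> 'a one_form \<Rightarrow> 'a bilinear_field \<Rightarrow> real \<Rightarrow> bool" where
  "kenmotsu_pseudo_metric A D \<phi> \<xi> \<eta> g \<epsilon> \<longleftrightarrow>
     almost_contact_pseudo_metric A \<phi> \<xi> \<eta> g \<epsilon> \<and>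
     levi_civita_connection A g D \<and>
     (\<forall>X\<in>vector_fields A. \<forall>Y\<in>vector_fields A.
        cov_deriv_endo D \<phi> X Y =
          - fmul (app \<eta> Y) (app \<phi> X) - fmul (\<epsilon> *\<^sub>R app2 g X (app \<phi> Y)) \<xi>)"

definition ricci_soliton ::
    "('a::topological_space, 'e::euclidean_space) chart set \<Rightarrow> 'a connection \<Rightarrow>
     'a bilinear_field \<Rightarrow> 'a vfield \<Rightarrow> real \<Rightarrow> bool" where
  "ricci_soliton A D g V l \<longleftrightarrow>
     V \<in> vector_fields A \<and> levi_civita_connection A g D \<and>
     (\<forall>X\<in>vector_fields A. \<forall>Y\<in>vector_fields A.
        lie_deriv_metric A V g X Y + 2 *\<^sub>R ricci A D X Y + (2 * l) *\<^sub>R app2 g X Y = 0)"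

definition expanding_ricci_soliton ::
    "('a::topological_space, 'e::euclidean_space) chart set \<Rightarrow> 'a connection \<Rightarrow>
     'a bilinear_field \<Rightarrow> 'a vfield \<Rightarrow> real \<Rightarrow> bool" where
  "expanding_ricci_soliton A D g V l \<longleftrightarrow> ricci_soliton A D g V l \<and> l > 0"

definition shrinking_ricci_soliton ::
    "('a::topological_space, 'e::euclidean_space) chart set \<Rightarrow> 'a connection \<Rightarrow>
     'a bilinear_field \<Rightarrow> 'a vfield \<Rightarrow> real \<Rightarrow> bool" where
  "shrinking_ricci_soliton A D g V l \<longleftrightarrow> ricci_soliton A D g V l \<and> l < 0"

text \<open>The constant \<open>\<epsilon>\<close> of the structure is the value of \<open>g(\<xi>,\<xi>)\<close>:\<close>

lemma g_xi_xi:
  fixes A :: "('a::topological_space, 'e::euclidean_space) chart set"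
  assumes "almost_contact_pseudo_metric A \<phi> \<xi> \<eta> g \<epsilon>"
  shows "app2 g \<xi> \<xi> = (\<lambda>p. \<epsilon>)"
proof
  fix p
  have xi: "\<xi> \<in> vector_fields A" and m: "pseudo_riemannian_metric A g"
    and phi: "app \<phi> \<xi> = 0" and eta: "app \<eta> \<xi> = 1"
    and c: "app2 g (app \<phi> \<xi>) (app \<phi> \<xi>) = app2 g \<xi> \<xi> - \<epsilon> *\<^sub>R (app \<eta> \<xi> * app \<eta> \<xi>)"
    using assms unfolding almost_contact_pseudo_metric_def by blast+
  have z: "(0 :: 'a tangent) \<in> tangent_space A p"
    by (simp add: tangent_space_def linear_on_set_def)
  then have "linear_on_set (tangent_space A p) (g p 0)"
    using m unfolding pseudo_riemannian_metric_def by blast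
  then have "g p 0 (0 *\<^sub>R 0) = 0 *\<^sub>R g p 0 0"
    using z unfolding linear_on_set_def by blast
  then have "g p 0 0 = 0" by simp
  then show "app2 g \<xi> \<xi> p = \<epsilon>"
    using fun_cong[OF c, of p] phi eta by (simp add: app2_def scaleR_fun_def)
qed

end

theory Submission
  imports Defs
begin

text \<open>
Write \<open>H = g - \<epsilon> \<eta> \<otimes> \<eta>\<close> for the part of the metric on \<open>\<xi>\<^sup>\<bottom>\<close>. A Kenmotsu manifold is locally a
warped product \<open>\<epsilon> dt\<^sup>2 + e\<^bsup>2t\<^esup> h\<close> with \<open>\<xi> = \<partial>\<^sub>t\<close>. In such a product the horizontal part of the soliton equation
compares the functions \<open>1\<close>, \<open>e\<^bsup>2t\<^esup>\<close> and \<open>t e\<^bsup>2t\<^esup>\<close>; the last one occurs only with the coefficient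
\<open>2 c h\<close>, where \<open>c = 2n \<epsilon> - \<lambda>\<close>. These functions are linearly independent and \<open>h \<noteq> 0\<close>, so \<open>c = 0\<close>. The
proof carries out this comparison without coordinates: taking the coefficient of \<open>t e\<^bsup>2t\<^esup>\<close> becomes
applying the Lie derivative along \<open>\<xi>\<close>.

The Kenmotsu equation gives \<open>\<nabla>\<^sub>X \<xi> = X - \<eta>(X) \<xi>\<close> (\<open>D_xi\<close>); hence \<open>d\<eta> = 0\<close>, \<open>\<pounds>\<^sub>\<xi> \<eta> = 0\<close> and
\<open>\<pounds>\<^sub>\<xi> g = 2 H\<close>. This fixes \<open>R(X,Y) \<xi>\<close>, hence \<open>Ric(X,\<xi>) = -2n \<eta>(X)\<close> (\<open>ricci_xi\<close>), and also
\<open>\<pounds>\<^sub>\<xi> \<nabla> = -2 \<epsilon> H \<otimes> \<xi>\<close> (\<open>Lie_xi_D_eq\<close>), from which \<open>\<pounds>\<^sub>\<xi> R\<close> (\<open>Lie_R\<close>) and, after taking a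
trace, \<open>\<pounds>\<^sub>\<xi> Ric = -4n \<epsilon> H\<close> (\<open>Lie_ricci\<close>) follow.

Now let \<open>P = \<pounds>\<^sub>V g = -2 Ric - 2 \<lambda> g\<close>, \<open>f = \<eta>(V)\<close> and \<open>U = [\<xi>,V]\<close>. Then \<open>\<pounds>\<^sub>\<xi> P = 4 c H\<close>. The soliton
equation on \<open>(X,\<xi>)\<close> says \<open>g(X,U) = 2 \<epsilon> c \<eta>(X) - \<epsilon> df(X)\<close>, whence \<open>\<xi> f = \<eta>(U) = c\<close> and
\<open>[\<xi>,U] = 2 c \<xi> - 2 U\<close>. The rule \<open>\<pounds>\<^bsub>[\<xi>,V]\<^esub> = [\<pounds>\<^sub>\<xi>, \<pounds>\<^sub>V]\<close> gives
\<open>\<pounds>\<^sub>U g = 4 c H - 2 P + 2 \<epsilon> (df \<otimes> \<eta> + \<eta> \<otimes> df)\<close>, and this is annihilated by \<open>\<pounds>\<^sub>\<xi>\<close>. The same rule for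
\<open>[\<xi>,U]\<close> then reads \<open>4 c H - 2 \<pounds>\<^sub>U g = - 2 \<pounds>\<^sub>U g\<close>, so \<open>c H = 0\<close> and \<open>c = 0\<close> (\<open>soliton_constant\<close>).

Tangent vectors are derivations here, and the Ricci tensor is a trace over a tangent space. What the
tensor calculus above uses of the manifold is therefore the existence of local frames \<open>E\<^sub>b\<close>
together with globally defined smooth functions \<open>u\<^sub>b\<close> such that every tangent vector near a given point is
\<open>v = \<Sum>\<^sub>b v(u\<^sub>b) E\<^sub>b\<close> (\<open>local_frame\<close>). This rests on Hadamard's lemma and on plateau functions.
\<close>

section \<open>Calculus of \<open>Ck\<close> functions on open sets\<close>

lemma Ck_on_cong:
  fixes f g :: "'e::real_normed_vector \<Rightarrow> 'b::real_normed_vector"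
  assumes "open S" "Ck_on k S f" "\<And>x. x \<in> S \<Longrightarrow> f x = g x"
  shows "Ck_on k S g"
  using assms(2,3)
proof (induction k arbitrary: f g)
  case 0
  then show ?case
    by (metis Ck_on.simps(1) continuous_on_cong)
next
  case (Suc k)
  have g: "(g has_derivative frechet_derivative f (at x)) (at x)" if "x \<in> S" for x
    using Suc.prems that \<open>open S\<close>
    by (metis Ck_on.simps(2) frechet_derivative_works has_derivative_transform_within_open)
  have "Ck_on k S (\<lambda>x. frechet_derivative g (at x) v)" for v
  proof (rule Suc.IH)
    show "Ck_on k S (\<lambda>x. frechet_derivative f (at x) v)" using Suc.prems(1) by simp
    show "frechet_derivative f (at x) v = frechet_derivative g (at x) v" if "x \<in> S" for x
      by (rule fun_cong[OF frechet_derivative_at[OF g[OF that]]])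
  qed
  then show ?case using g by (auto simp: differentiable_def)
qed

lemma Ck_on_Suc_derivI:
  assumes "open S" "\<And>x. x \<in> S \<Longrightarrow> (f has_derivative f' x) (at x)"
    and "\<And>v. Ck_on k S (\<lambda>x. f' x v)"
  shows "Ck_on (Suc k) S f"
proof -
  have "f' x = frechet_derivative f (at x)" if "x \<in> S" for x
    using assms(2)[OF that] by (rule frechet_derivative_at)
  then have "Ck_on k S (\<lambda>x. frechet_derivative f (at x) v)" for v
    using Ck_on_cong[OF assms(1) assms(3)[of v]] by simp
  then show ?thesis
    using assms(2) by (auto simp: differentiable_def)
qed

lemma Ck_on_has_derivative:
  "Ck_on (Suc k) S f \<Longrightarrow> x \<in> S \<Longrightarrow> (f has_derivative frechet_derivative f (at x)) (at x)"
  using frechet_derivative_works by auto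

lemma Ck_on_SucD: "Ck_on (Suc k) S f \<Longrightarrow> Ck_on k S f"
proof (induction k arbitrary: f)
  case 0
  then show ?case
    by (simp add: differentiable_imp_continuous_within continuous_at_imp_continuous_on)
next
  case (Suc k)
  then show ?case by (metis Ck_on.simps(2))
qed

lemma Ck_on_imp_continuous_on: "Ck_on k S f \<Longrightarrow> continuous_on S f"
proof (induction k)
  case (Suc k)
  then show ?case using Ck_on_SucD by blast
qed simp

lemma Ck_on_subset: "Ck_on k S f \<Longrightarrow> T \<subseteq> S \<Longrightarrow> Ck_on k T f"
  by (induction k arbitrary: f) (auto intro: continuous_on_subset)

lemma Ck_on_Un:
  assumes "open S" "open T" "Ck_on k S f" "Ck_on k T f"
  shows "Ck_on k (S \<union> T) f"
  using assms(3,4)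
  by (induction k arbitrary: f) (auto intro: continuous_on_open_Un assms)

lemma Ck_on_const: "Ck_on k S (\<lambda>x. c)"
  by (induction k arbitrary: c) auto

lemma Ck_on_bounded_linear:
  assumes "open S" "bounded_linear L" "Ck_on k S f"
  shows "Ck_on k S (\<lambda>x. L (f x))"
  using assms(3)
proof (induction k arbitrary: f)
  case 0
  then show ?case
    by (simp add: bounded_linear.continuous_on[OF assms(2)])
next
  case (Suc k)
  show ?case
  proof (rule Ck_on_Suc_derivI[OF \<open>open S\<close>])
    show "((\<lambda>x. L (f x)) has_derivative (\<lambda>v. L (frechet_derivative f (at x) v))) (at x)"
      if "x \<in> S" for x
      by (rule bounded_linear.has_derivative[OF assms(2) Ck_on_has_derivative[OF Suc.prems that]])
  qed (use Suc in auto)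
qed

lemma Ck_on_id:
  assumes "open S"
  shows "Ck_on k S (\<lambda>x. x)"
proof (cases k)
  case (Suc j)
  then show ?thesis
    using Ck_on_Suc_derivI[OF assms, of "\<lambda>x. x" "\<lambda>x v. v"] by (simp add: Ck_on_const)
qed simp

lemma Ck_on_add:
  assumes "open S" "Ck_on k S f" "Ck_on k S g"
  shows "Ck_on k S (\<lambda>x. f x + g x)"
  using assms(2,3)
proof (induction k arbitrary: f g)
  case 0
  then show ?case by (simp add: continuous_on_add)
next
  case (Suc k)
  show ?case
    by (rule Ck_on_Suc_derivI[OF \<open>open S\<close>
          has_derivative_add[OF Ck_on_has_derivative[OF Suc.prems(1)]
            Ck_on_has_derivative[OF Suc.prems(2)]]])
      (use Suc in auto)
qed

lemma Ck_on_mult: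
  fixes f g :: "'e::real_normed_vector \<Rightarrow> real"
  assumes "open S" "Ck_on k S f" "Ck_on k S g"
  shows "Ck_on k S (\<lambda>x. f x * g x)"
  using assms(2,3)
proof (induction k arbitrary: f g)
  case 0
  then show ?case by (simp add: continuous_on_mult)
next
  case (Suc k)
  show ?case
  proof (rule Ck_on_Suc_derivI[OF \<open>open S\<close>
        has_derivative_mult[OF Ck_on_has_derivative[OF Suc.prems(1)]
          Ck_on_has_derivative[OF Suc.prems(2)]]])
    show "Ck_on k S (\<lambda>x. f x * frechet_derivative g (at x) v + frechet_derivative f (at x) v * g x)"
      for v
      using Suc.prems Ck_on_SucD by (intro Ck_on_add[OF \<open>open S\<close>] Suc.IH) auto
  qed
qed

lemma Ck_on_sum:
  assumes "open S" "finite I" "\<And>i. i \<in> I \<Longrightarrow> Ck_on k S (f i)"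
  shows "Ck_on k S (\<lambda>x. \<Sum>i\<in>I. f i x)"
  using assms(2,3)
  by (induction I rule: finite_induct) (auto intro: Ck_on_add[OF \<open>open S\<close>] Ck_on_const)

lemma Ck_on_inverse:
  fixes f :: "'e::real_normed_vector \<Rightarrow> real"
  assumes "open S" "Ck_on k S f" "\<And>x. x \<in> S \<Longrightarrow> f x \<noteq> 0"
  shows "Ck_on k S (\<lambda>x. inverse (f x))"
  using assms(2)
proof (induction k)
  case 0
  then show ?case by (simp add: continuous_on_inverse assms(3))
next
  case (Suc k)
  note f = Ck_on_has_derivative[OF Suc.prems]
  show ?case
  proof (rule Ck_on_Suc_derivI[OF \<open>open S\<close>])
    show "((\<lambda>x. inverse (f x)) has_derivative
        (\<lambda>v. - 1 * (inverse (f x) * frechet_derivative f (at x) v * inverse (f x)))) (at x)"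
      if "x \<in> S" for x
      using Deriv.has_derivative_inverse[OF _ f[OF that]] assms(3)[OF that] by simp
    show "Ck_on k S (\<lambda>x. - 1 * (inverse (f x) * frechet_derivative f (at x) v * inverse (f x)))" for v
      using Suc.prems
      by (intro Ck_on_mult[OF \<open>open S\<close>] Ck_on_const Suc.IH[OF Ck_on_SucD[OF Suc.prems]]) auto
  qed
qed

lemma linear_basis_expansion:
  fixes f :: "'e::euclidean_space \<Rightarrow> real"
  assumes "linear f"
  shows "f w = (\<Sum>b\<in>Basis. (w \<bullet> b) * f b)"
proof -
  have "f (\<Sum>b\<in>Basis. (w \<bullet> b) *\<^sub>R b) = (\<Sum>b\<in>Basis. f ((w \<bullet> b) *\<^sub>R b))"
    by (rule linear_sum[OF assms])
  then show ?thesis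
    unfolding euclidean_representation by (simp add: linear_cmul[OF assms])
qed

lemma Ck_on_compose:
  fixes f :: "'e::euclidean_space \<Rightarrow> real" and h :: "'d::real_normed_vector \<Rightarrow> 'e"
  assumes "open S" "open T" "Ck_on k T f" "Ck_on k S h" "h ` S \<subseteq> T"
  shows "Ck_on k S (\<lambda>x. f (h x))"
  using assms(3,4)
proof (induction k arbitrary: f)
  case 0
  then show ?case using continuous_on_compose2 assms(5) by auto
next
  case (Suc k)
  let ?df = "\<lambda>x. frechet_derivative f (at x)" and ?dh = "\<lambda>x. frechet_derivative h (at x)"
  show ?case
  proof (rule Ck_on_Suc_derivI[OF \<open>open S\<close>])
    fix x assume x: "x \<in> S"
    have df: "(f has_derivative ?df (h x)) (at (h x))"
      using Ck_on_has_derivative[OF Suc.prems(1)] x assms(5) by blast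
    have "((\<lambda>x. f (h x)) has_derivative (\<lambda>v. ?df (h x) (?dh x v))) (at x)"
      by (rule has_derivative_compose[OF Ck_on_has_derivative[OF Suc.prems(2) x] df])
    then show "((\<lambda>x. f (h x)) has_derivative
        (\<lambda>v. \<Sum>b\<in>Basis. (?dh x v \<bullet> b) * ?df (h x) b)) (at x)"
      by (rule has_derivative_eq_rhs)
        (rule ext, rule linear_basis_expansion[OF has_derivative_linear[OF df]])
  next
    show "Ck_on k S (\<lambda>x. \<Sum>b\<in>Basis. (?dh x v \<bullet> b) * ?df (h x) b)" for v
      using Suc.prems
      by (intro Ck_on_sum[OF \<open>open S\<close>] Ck_on_mult[OF \<open>open S\<close>] Suc.IH
          Ck_on_bounded_linear[OF \<open>open S\<close> bounded_linear_inner_left]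
          Ck_on_SucD[OF Suc.prems(2)]) auto
  qed
qed

lemma smooth_on_Ck: "smooth_on S f \<Longrightarrow> Ck_on k S f"
  by (simp add: smooth_on_def)

lemma smooth_on_has_derivative:
  "smooth_on S f \<Longrightarrow> x \<in> S \<Longrightarrow> (f has_derivative frechet_derivative f (at x)) (at x)"
  by (rule Ck_on_has_derivative[OF smooth_on_Ck[of _ _ 1, simplified One_nat_def]])

lemma smooth_on_frechet_derivative:
  "smooth_on S f \<Longrightarrow> smooth_on S (\<lambda>x. frechet_derivative f (at x) v)"
  unfolding smooth_on_def by (metis Ck_on.simps(2))

lemma smooth_on_cong:
  "open S \<Longrightarrow> smooth_on S f \<Longrightarrow> (\<And>x. x \<in> S \<Longrightarrow> f x = g x) \<Longrightarrow> smooth_on S g"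
  unfolding smooth_on_def using Ck_on_cong by blast

lemma smooth_on_subset: "smooth_on S f \<Longrightarrow> T \<subseteq> S \<Longrightarrow> smooth_on T f"
  by (auto simp: smooth_on_def intro: Ck_on_subset)

lemma smooth_on_Un:
  "open S \<Longrightarrow> open T \<Longrightarrow> smooth_on S f \<Longrightarrow> smooth_on T f \<Longrightarrow> smooth_on (S \<union> T) f"
  by (auto simp: smooth_on_def intro: Ck_on_Un)

lemma smooth_on_const: "smooth_on S (\<lambda>x. c)"
  by (simp add: smooth_on_def Ck_on_const)

lemma smooth_on_id: "open S \<Longrightarrow> smooth_on S (\<lambda>x. x)"
  by (simp add: smooth_on_def Ck_on_id)

lemma smooth_on_bounded_linear:
  "open S \<Longrightarrow> bounded_linear L \<Longrightarrow> smooth_on S f \<Longrightarrow> smooth_on S (\<lambda>x. L (f x))"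
  by (simp add: smooth_on_def Ck_on_bounded_linear)

lemma smooth_on_add:
  "open S \<Longrightarrow> smooth_on S f \<Longrightarrow> smooth_on S g \<Longrightarrow> smooth_on S (\<lambda>x. f x + g x)"
  by (simp add: smooth_on_def Ck_on_add)

lemma smooth_on_mult:
  fixes f g :: "'e::real_normed_vector \<Rightarrow> real"
  shows "open S \<Longrightarrow> smooth_on S f \<Longrightarrow> smooth_on S g \<Longrightarrow> smooth_on S (\<lambda>x. f x * g x)"
  by (simp add: smooth_on_def Ck_on_mult)

lemma smooth_on_sum:
  "open S \<Longrightarrow> finite I \<Longrightarrow> (\<And>i. i \<in> I \<Longrightarrow> smooth_on S (f i)) \<Longrightarrow> smooth_on S (\<lambda>x. \<Sum>i\<in>I. f i x)"
  by (simp add: smooth_on_def Ck_on_sum)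

lemma smooth_on_inverse:
  fixes f :: "'e::real_normed_vector \<Rightarrow> real"
  shows "open S \<Longrightarrow> smooth_on S f \<Longrightarrow> (\<And>x. x \<in> S \<Longrightarrow> f x \<noteq> 0) \<Longrightarrow>
    smooth_on S (\<lambda>x. inverse (f x))"
  by (simp add: smooth_on_def Ck_on_inverse)

lemma smooth_on_compose:
  fixes f :: "'e::euclidean_space \<Rightarrow> real" and h :: "'d::real_normed_vector \<Rightarrow> 'e"
  assumes "open S" "open T" "smooth_on T f" "smooth_on S h" "h ` S \<subseteq> T"
  shows "smooth_on S (\<lambda>x. f (h x))"
  using assms Ck_on_compose unfolding smooth_on_def by blast

section \<open>Plateau functions\<close>

text \<open>
The family is closed under differentiation up to linear combinations, so all its members are smooth as
soon as all of them are differentiable. The only delicate point is \<open>t = 0\<close>, where exponential decay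
beats every power.
\<close>

definition flat_exp :: "nat \<Rightarrow> real \<Rightarrow> real" where
  "flat_exp k t = (if t > 0 then exp (- (1 / t)) / t ^ k else 0)"

lemma flat_exp_tendsto_0: "(flat_exp k \<longlongrightarrow> 0) (at 0)"
proof (rule filterlim_split_at)
  show "(flat_exp k \<longlongrightarrow> 0) (at_left 0)"
    by (rule tendsto_eventually) (auto simp: flat_exp_def eventually_at_filter)
  have "((\<lambda>t. inverse t ^ k / exp (inverse t)) \<longlongrightarrow> (0::real)) (at_right 0)"
    by (rule filterlim_compose[OF tendsto_power_div_exp_0 filterlim_inverse_at_top_right])
  then show "(flat_exp k \<longlongrightarrow> 0) (at_right 0)"
  proof (rule Lim_transform_eventually)
    show "\<forall>\<^sub>F t in at_right 0. inverse t ^ k / exp (inverse t) = flat_exp k t"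
      by (auto simp: flat_exp_def eventually_at_filter exp_minus field_simps)
  qed
qed

lemma flat_exp_has_derivative:
  "(flat_exp k has_real_derivative (flat_exp (k + 2) t - real k * flat_exp (k + 1) t)) (at t)"
proof (cases t "0::real" rule: linorder_cases)
  case less
  have "((\<lambda>t. 0) has_real_derivative (flat_exp (k + 2) t - real k * flat_exp (k + 1) t)) (at t)"
    using less by (simp add: flat_exp_def)
  then show ?thesis
    by (rule has_field_derivative_transform_within_open[of _ _ _ "{..<0}"])
      (use less in \<open>auto simp: flat_exp_def\<close>)
next
  case equal
  have "((\<lambda>h. (flat_exp k h - flat_exp k 0) / (h - 0)) \<longlongrightarrow> 0) (at 0)"
  proof (rule Lim_transform_eventually[OF flat_exp_tendsto_0[of "k + 1"]])
    show "\<forall>\<^sub>F h in at 0. flat_exp (k + 1) h = (flat_exp k h - flat_exp k 0) / (h - 0)"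
      by (auto simp: flat_exp_def eventually_at_filter)
  qed
  then have "(flat_exp k has_real_derivative 0) (at 0)"
    by (simp add: has_field_derivative_iff)
  then show ?thesis using equal by (simp add: flat_exp_def)
next
  case greater
  have "((\<lambda>t. exp (- (1 / t)) / t ^ k) has_real_derivative
      (exp (- (1 / t)) * (1 / t ^ 2) * t ^ k - exp (- (1 / t)) * (real k * t ^ (k - 1))) / (t ^ k * t ^ k)) (at t)"
    using greater by (auto intro!: derivative_eq_intros simp: power2_eq_square)
  moreover have "(exp (- (1 / t)) * (1 / t ^ 2) * t ^ k - exp (- (1 / t)) * (real k * t ^ (k - 1))) / (t ^ k * t ^ k)
      = flat_exp (k + 2) t - real k * flat_exp (k + 1) t"
    using greater by (cases k) (auto simp: flat_exp_def field_simps power2_eq_square)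
  ultimately have "((\<lambda>t. exp (- (1 / t)) / t ^ k) has_real_derivative
      (flat_exp (k + 2) t - real k * flat_exp (k + 1) t)) (at t)" by simp
  then show ?thesis
    by (rule has_field_derivative_transform_within_open[of _ _ _ "{0<..}"])
      (use greater in \<open>auto simp: flat_exp_def\<close>)
qed

lemma smooth_flat_exp: "smooth_on UNIV (flat_exp k)"
proof -
  have "Ck_on m UNIV (flat_exp k)" for m
  proof (induction m arbitrary: k)
    case 0
    show ?case
      using flat_exp_has_derivative
      by (auto intro!: continuous_at_imp_continuous_on DERIV_isCont)
  next
    case (Suc m)
    show ?case
    proof (rule Ck_on_Suc_derivI)
      show "(flat_exp k has_derivative
          (\<lambda>v. (flat_exp (k + 2) t + (- real k) * flat_exp (k + 1) t) * v)) (at t)" for t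
        using flat_exp_has_derivative[of k t] by (simp add: has_field_derivative_def)
      show "Ck_on m UNIV (\<lambda>t. (flat_exp (k + 2) t + (- real k) * flat_exp (k + 1) t) * v)" for v
        by (intro Ck_on_mult Ck_on_add Ck_on_const Suc.IH) auto
    qed auto
  qed
  then show ?thesis by (simp add: smooth_on_def)
qed

text \<open>
A smooth transition from \<open>0\<close> (for \<open>t \<le> 0\<close>) to \<open>1\<close> (for \<open>t \<ge> 1\<close>).
\<close>

definition smooth_step :: "real \<Rightarrow> real" where
  "smooth_step t = flat_exp 0 t * inverse (flat_exp 0 t + flat_exp 0 (1 - t))"

lemma smooth_smooth_step: "smooth_on UNIV smooth_step"
proof -
  have pos: "flat_exp 0 t + flat_exp 0 (1 - t) \<noteq> 0" for t
  proof -
    have "flat_exp 0 t \<ge> 0" "flat_exp 0 (1 - t) \<ge> 0" "flat_exp 0 t > 0 \<or> flat_exp 0 (1 - t) > 0"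
      by (auto simp: flat_exp_def)
    then show ?thesis by linarith
  qed
  have "smooth_on UNIV (\<lambda>t::real. 1 + (- t))"
    by (intro smooth_on_add smooth_on_const smooth_on_bounded_linear[OF _ bounded_linear_minus] smooth_on_id)
      (auto intro: bounded_linear_ident)
  then have "smooth_on UNIV (\<lambda>t. flat_exp 0 (1 + (- t)))"
    using smooth_on_compose[OF _ _ smooth_flat_exp] by blast
  then have "smooth_on UNIV (\<lambda>t. flat_exp 0 t * inverse (flat_exp 0 t + flat_exp 0 (1 + (- t))))"
    using pos by (intro smooth_on_mult smooth_on_inverse smooth_on_add smooth_flat_exp) auto
  then show ?thesis by (simp add: smooth_step_def[abs_def])
qed

lemma plateau_exists:
  fixes a :: "'e::euclidean_space"
  assumes "r > 0"
  obtains \<psi> :: "'e \<Rightarrow> real" where "smooth_on UNIV \<psi>"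
    "\<And>x. x \<in> ball a r \<Longrightarrow> \<psi> x = 1" "\<And>x. x \<notin> cball a (2 * r) \<Longrightarrow> \<psi> x = 0"
proof
  let ?q = "\<lambda>x::'e. \<Sum>b\<in>Basis. ((x \<bullet> b) + - (a \<bullet> b)) * ((x \<bullet> b) + - (a \<bullet> b))"
  have q: "?q x = (dist a x)\<^sup>2" for x
    unfolding dist_norm norm_minus_commute[of a] power2_norm_eq_inner
    by (subst euclidean_inner) (simp add: inner_diff_left)
  \<comment> \<open>The argument of the step is at least \<open>1\<close> on \<open>ball a r\<close> and at most \<open>0\<close> outside \<open>cball a (2 * r)\<close>.\<close>
  let ?\<psi> = "\<lambda>x. smooth_step (2 + (- inverse (r\<^sup>2)) * ?q x)"
  have "smooth_on UNIV (\<lambda>x. 2 + (- inverse (r\<^sup>2)) * ?q x)"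
    by (intro smooth_on_add smooth_on_mult smooth_on_sum smooth_on_const
        smooth_on_bounded_linear[OF _ bounded_linear_inner_left] smooth_on_id) auto
  then show "smooth_on UNIV ?\<psi>"
    using smooth_on_compose[OF _ _ smooth_smooth_step] by blast
  show "?\<psi> x = 1" if "x \<in> ball a r" for x
  proof -
    have "(dist a x)\<^sup>2 \<le> r\<^sup>2" using that by (intro power_mono) auto
    then have "2 - inverse (r\<^sup>2) * (dist a x)\<^sup>2 \<ge> 1"
      using assms by (simp add: field_simps)
    then show ?thesis unfolding q by (simp add: smooth_step_def flat_exp_def)
  qed
  show "?\<psi> x = 0" if "x \<notin> cball a (2 * r)" for x
  proof -
    have "(2 * r)\<^sup>2 \<le> (dist a x)\<^sup>2" using that assms by (intro power_mono) auto
    moreover have "2 * r\<^sup>2 \<le> (2 * r)\<^sup>2" by (simp add: power_mult_distrib)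
    ultimately have "2 * r\<^sup>2 \<le> (dist a x)\<^sup>2" by linarith
    then have "2 - inverse (r\<^sup>2) * (dist a x)\<^sup>2 \<le> 0"
      using assms by (simp add: field_simps)
    then show ?thesis unfolding q by (simp add: smooth_step_def flat_exp_def)
  qed
qed

section \<open>Hadamard's lemma\<close>

text \<open>
The derivative of the integrand in a direction \<open>v\<close> is \<open>t\<^bsup>m+1\<^esup> dH(a + t(y - a)) v\<close>, which is again of
the same shape with one more power of \<open>t\<close> and with \<open>H\<close> replaced by one of its directional derivatives.
Allowing an arbitrary power of \<open>t\<close> is what makes the induction on \<open>k\<close> go through.
\<close>

lemma Ck_on_param_integral:
  fixes H :: "'e::euclidean_space \<Rightarrow> real"
  assumes "open S" "convex S" "a \<in> S" "Ck_on k S H"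
  shows "Ck_on k S (\<lambda>y. integral {0..1} (\<lambda>t::real. t ^ m * H (a + t *\<^sub>R (y - a))))"
  using assms(4)
proof (induction k arbitrary: H m)
  have in_S: "a + t *\<^sub>R (y - a) \<in> S" if "y \<in> S" "t \<in> {0..1}" for y and t :: real
    using convexD_alt[OF \<open>convex S\<close> \<open>a \<in> S\<close> that(1), of t] that(2) by (simp add: algebra_simps)
  have cont: "continuous_on (S \<times> cbox 0 1) (\<lambda>(y, t::real). t ^ m * H (a + t *\<^sub>R (y - a)))"
    if "continuous_on S H" for H :: "'e \<Rightarrow> real" and m
    unfolding case_prod_beta
    by (intro continuous_intros continuous_on_compose2[OF that]) (auto intro: in_S)
  {
    case 0
    then show ?case
      using integral_continuous_on_param[OF cont[of H m]] by simp
  next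
    case (Suc k)
    let ?d = "\<lambda>x. frechet_derivative H (at x)"
    let ?f = "\<lambda>y t::real. t ^ m * H (a + t *\<^sub>R (y - a))"
    let ?f' = "\<lambda>y t::real. Blinfun (\<lambda>v. t ^ (Suc m) * ?d (a + t *\<^sub>R (y - a)) v)"
    note dH = Ck_on_has_derivative[OF Suc.prems]
    have apply': "blinfun_apply (?f' y t) = (\<lambda>v. t ^ (Suc m) * ?d (a + t *\<^sub>R (y - a)) v)"
      if "y \<in> S" "t \<in> {0..1}" for y t
      by (intro bounded_linear_Blinfun_apply bounded_linear_const_mult
          has_derivative_bounded_linear[OF dH[OF in_S[OF that]]])
    have deriv: "((\<lambda>y. ?f y t) has_derivative blinfun_apply (?f' y t)) (at y)"
      if "y \<in> S" "t \<in> {0..1}" for y t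
    proof -
      have lin: "((\<lambda>y. a + t *\<^sub>R (y - a)) has_derivative (\<lambda>v. t *\<^sub>R v)) (at y)"
        by (auto intro!: derivative_eq_intros)
      have "((\<lambda>y. H (a + t *\<^sub>R (y - a))) has_derivative
          (\<lambda>v. ?d (a + t *\<^sub>R (y - a)) (t *\<^sub>R v))) (at y)"
        by (rule has_derivative_compose[OF lin dH[OF in_S[OF that]]])
      then have "((\<lambda>y. ?f y t) has_derivative
          (\<lambda>v. t ^ m * ?d (a + t *\<^sub>R (y - a)) (t *\<^sub>R v))) (at y)"
        by (rule has_derivative_mult_right)
      then show ?thesis
        unfolding apply'[OF that]
        using has_derivative_linear[OF dH[OF in_S[OF that]]] by (simp add: linear_cmul mult.assoc mult.left_commute)
    qed
    have cont': "continuous_on (S \<times> cbox 0 1) (\<lambda>(y, t). ?f' y t)"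
    proof (rule continuous_on_blinfun_componentwise)
      fix i :: 'e
      have "continuous_on S (\<lambda>x. ?d x i)"
        using Suc.prems by (intro Ck_on_imp_continuous_on[of k]) auto
      from cont[OF this, of "Suc m"]
      show "continuous_on (S \<times> cbox 0 1) (\<lambda>x. blinfun_apply (case x of (y, t) \<Rightarrow> ?f' y t) i)"
        by (rule continuous_on_eq) (auto simp: apply' simp del: power_Suc)
    qed
    have int: "?f y integrable_on cbox 0 1" if "y \<in> S" for y
    proof (rule integrable_continuous)
      have "continuous_on S H" by (rule Ck_on_imp_continuous_on[OF Suc.prems])
      show "continuous_on (cbox 0 1) (?f y)"
        by (intro continuous_intros continuous_on_compose2[OF \<open>continuous_on S H\<close>])
          (auto intro: in_S[OF that])
    qed
    have int': "?f' y integrable_on cbox 0 1" if "y \<in> S" for y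
    proof (rule integrable_continuous)
      have "continuous_on (cbox 0 1) (Pair y)" "Pair y ` cbox 0 1 \<subseteq> S \<times> cbox (0::real) 1"
        using that by (auto intro!: continuous_intros)
      from continuous_on_compose2[OF cont' this] show "continuous_on (cbox 0 1) (?f' y)"
        by simp
    qed
    have app_int: "blinfun_apply (integral {0..1} (?f' y)) v =
        integral {0..1} (\<lambda>t. t ^ (Suc m) * ?d (a + t *\<^sub>R (y - a)) v)" if "y \<in> S" for y v
    proof -
      have "blinfun_apply (integral {0..1} (?f' y)) v =
          integral {0..1} (\<lambda>t. blinfun_apply (?f' y t) v)"
        by (rule blinfun_apply_integral[OF int'[OF that, unfolded cbox_interval]])
      also have "\<dots> = integral {0..1} (\<lambda>t. t ^ (Suc m) * ?d (a + t *\<^sub>R (y - a)) v)"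
        by (rule integral_cong) (use that apply' in auto)
      finally show ?thesis .
    qed
    show ?case
    proof (rule Ck_on_Suc_derivI[OF \<open>open S\<close>])
      fix y assume y: "y \<in> S"
      have "((\<lambda>y. integral (cbox 0 1) (?f y)) has_derivative
          blinfun_apply (integral (cbox 0 1) (?f' y))) (at y within S)"
        by (rule leibniz_rule[OF has_derivative_at_withinI[OF deriv] int cont' y \<open>convex S\<close>])
          (simp_all add: cbox_interval)
      then show "((\<lambda>y. integral {0..1} (?f y)) has_derivative
          (\<lambda>v. integral {0..1} (\<lambda>t. t ^ (Suc m) * ?d (a + t *\<^sub>R (y - a)) v))) (at y)"
        unfolding cbox_interval ext[OF app_int[OF y]] at_within_open[OF y \<open>open S\<close>] .
    next
      show "Ck_on k S (\<lambda>y. integral {0..1} (\<lambda>t. t ^ (Suc m) * ?d (a + t *\<^sub>R (y - a)) v))" for v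
        using Suc.prems by (intro Suc.IH) simp
    qed
  }
qed

text \<open>
Integrating \<open>dF\<close> along the segment from \<open>a\<close> to \<open>y\<close> writes \<open>F - F a\<close> as a combination of the coordinate functions
\<open>(y - a) \<bullet> b\<close> with smooth coefficients. A derivation at \<open>a\<close> is therefore determined by its values on
coordinates.
\<close>

lemma hadamard:
  fixes F :: "'e::euclidean_space \<Rightarrow> real"
  assumes "open S" "convex S" "a \<in> S" "smooth_on S F"
  obtains G where "\<And>b. smooth_on S (G b)"
    "\<And>b. G b a = frechet_derivative F (at a) b"
    "\<And>y. y \<in> S \<Longrightarrow> F y = F a + (\<Sum>b\<in>Basis. ((y - a) \<bullet> b) * G b y)"
proof
  let ?d = "\<lambda>x. frechet_derivative F (at x)"
  let ?G = "\<lambda>b y. integral {0..1} (\<lambda>t::real. t ^ 0 * ?d (a + t *\<^sub>R (y - a)) b)"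
  note dF = smooth_on_has_derivative[OF assms(4)]
  show "smooth_on S (?G b)" for b
    using Ck_on_param_integral[OF assms(1-3), of _ "\<lambda>x. ?d x b" 0]
      smooth_on_frechet_derivative[OF assms(4), of b] by (simp add: smooth_on_def)
  show "?G b a = ?d a b" for b by simp
  show "F y = F a + (\<Sum>b\<in>Basis. ((y - a) \<bullet> b) * ?G b y)" if y: "y \<in> S" for y
  proof -
    have in_S: "a + t *\<^sub>R (y - a) \<in> S" if "t \<in> {0..1}" for t :: real
      using convexD_alt[OF \<open>convex S\<close> \<open>a \<in> S\<close> y, of t] that by (simp add: algebra_simps)
    have rep: "?d x w = (\<Sum>b\<in>Basis. (w \<bullet> b) * ?d x b)" if "x \<in> S" for x w
      by (rule linear_basis_expansion[OF has_derivative_linear[OF dF[OF that]]])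
    have "((\<lambda>t. ?d (a + t *\<^sub>R (y - a)) (y - a)) has_integral
        F (a + 1 *\<^sub>R (y - a)) - F (a + 0 *\<^sub>R (y - a))) {0..1::real}"
    proof (rule fundamental_theorem_of_calculus)
      fix t :: real assume t: "t \<in> {0..1}"
      have lin: "((\<lambda>t. a + t *\<^sub>R (y - a)) has_derivative (\<lambda>s. s *\<^sub>R (y - a))) (at t)"
        by (auto intro!: derivative_eq_intros)
      have "((\<lambda>t. F (a + t *\<^sub>R (y - a))) has_derivative
          (\<lambda>s. ?d (a + t *\<^sub>R (y - a)) (s *\<^sub>R (y - a)))) (at t)"
        by (rule has_derivative_compose[OF lin dF[OF in_S[OF t]]])
      then have "((\<lambda>t. F (a + t *\<^sub>R (y - a))) has_vector_derivative
          ?d (a + t *\<^sub>R (y - a)) (y - a)) (at t)"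
        using has_derivative_linear[OF dF[OF in_S[OF t]]]
        by (simp add: has_vector_derivative_def linear_cmul)
      then show "((\<lambda>t. F (a + t *\<^sub>R (y - a))) has_vector_derivative
          ?d (a + t *\<^sub>R (y - a)) (y - a)) (at t within {0..1})"
        by (rule has_vector_derivative_at_within)
    qed simp
    then have "F y - F a = integral {0..1} (\<lambda>t. ?d (a + t *\<^sub>R (y - a)) (y - a))"
      by (simp add: integral_unique)
    also have "\<dots> = integral {0..1} (\<lambda>t. \<Sum>b\<in>Basis. ((y - a) \<bullet> b) * ?d (a + t *\<^sub>R (y - a)) b)"
      by (rule integral_cong) (rule rep[OF in_S])
    also have "\<dots> = (\<Sum>b\<in>Basis. ((y - a) \<bullet> b) * ?G b y)"
    proof (subst integral_sum)
      fix b :: 'e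
      have "continuous_on S (\<lambda>x. ?d x b)"
        using smooth_on_Ck[OF smooth_on_frechet_derivative[OF assms(4)], of 0] by simp
      then have "continuous_on {0..1} (\<lambda>t::real. ?d (a + t *\<^sub>R (y - a)) b)"
        by (rule continuous_on_compose2) (auto intro!: continuous_intros in_S)
      then show "(\<lambda>t. ((y - a) \<bullet> b) * ?d (a + t *\<^sub>R (y - a)) b) integrable_on {0..1}"
        by (intro integrable_continuous_real continuous_intros)
    qed auto
    finally show ?thesis by simp
  qed
qed

section \<open>Smooth functions and tangent vectors\<close>

lemma sum_fun_apply: "(\<Sum>i\<in>I. F i) x = (\<Sum>i\<in>I. F i x)"
  by (induction I rule: infinite_finite_induct) auto

locale smooth_manifold =
  fixes A :: "('a::t2_space, 'e::euclidean_space) chart set"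
  assumes atlas: "smooth_atlas A"
begin

abbreviation "C \<equiv> smooth_functions A"
abbreviation "VF \<equiv> vector_fields A"

lemma chart_facts:
  assumes "(U, x) \<in> A"
  shows chart_open: "open U" and chart_open_image: "open (x ` U)" and chart_inj: "inj_on x U"
    and chart_cont: "continuous_on U x" and chart_inv_cont: "continuous_on (x ` U) (inv_into U x)"
proof -
  have "is_chart (U, x)" using assms atlas by (auto simp: smooth_atlas_def)
  then obtain y where U: "open U" "open (x ` U)" and h: "homeomorphism U (x ` U) x y"
    by (auto simp: is_chart_def)
  show "open U" "open (x ` U)" by fact+
  show "continuous_on U x" using h by (simp add: homeomorphism_def)
  show inj: "inj_on x U" 
    by (rule inj_on_inverseI[of U y]) (use h in \<open>simp add: homeomorphism_def\<close>)
  have "continuous_on (x ` U) y" using h by (simp add: homeomorphism_def)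
  then show "continuous_on (x ` U) (inv_into U x)"
    by (rule continuous_on_eq) (use h inj in \<open>auto simp: homeomorphism_def\<close>)
qed

lemma chart_inv: "(U, x) \<in> A \<Longrightarrow> q \<in> U \<Longrightarrow> inv_into U x (x q) = q"
  using chart_inj by auto

lemma chart_at: obtains U x where "(U, x) \<in> A" "p \<in> U"
proof -
  have "p \<in> (\<Union>c\<in>A. fst c)" using atlas by (simp add: smooth_atlas_def)
  then show ?thesis using that by auto
qed

lemma chart_image_open:
  assumes "(V, y) \<in> A" "open W"
  shows "open (y ` (V \<inter> W))"
proof -
  have "y ` (V \<inter> W) = inv_into V y -` W \<inter> y ` V"
    using chart_inv[OF assms(1)] by auto
  then show ?thesis
    using chart_inv_cont[OF assms(1)] assms
    by (simp add: continuous_on_open_vimage[OF chart_open_image[OF assms(1)]])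
qed

lemma chart_preimage_open:
  assumes "(U, x) \<in> A" "open S"
  shows "open {q \<in> U. x q \<in> S}"
proof -
  have "{q \<in> U. x q \<in> S} = x -` S \<inter> U" by auto
  then show ?thesis
    using chart_cont[OF assms(1)] assms
    by (simp add: continuous_on_open_vimage[OF chart_open[OF assms(1)]])
qed

lemma smooth_functions_iff:
  "f \<in> C \<longleftrightarrow> (\<forall>U x. (U, x) \<in> A \<longrightarrow> smooth_on (x ` U) (\<lambda>z. f (inv_into U x z)))"
  by (auto simp: smooth_functions_def comp_def)

lemma smooth_functionsD:
  "f \<in> C \<Longrightarrow> (U, x) \<in> A \<Longrightarrow> smooth_on (x ` U) (\<lambda>z. f (inv_into U x z))"
  by (simp add: smooth_functions_iff)

lemma C_const: "(\<lambda>p. c) \<in> C"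
  by (simp add: smooth_functions_iff smooth_on_const)

lemma C_add: "f \<in> C \<Longrightarrow> h \<in> C \<Longrightarrow> f + h \<in> C"
  by (auto simp: smooth_functions_iff intro!: smooth_on_add[OF chart_open_image])

lemma C_mult: "f \<in> C \<Longrightarrow> h \<in> C \<Longrightarrow> f * h \<in> C"
  by (auto simp: smooth_functions_iff intro!: smooth_on_mult[OF chart_open_image])

lemma C_scaleR: "f \<in> C \<Longrightarrow> c *\<^sub>R f \<in> C"
  using C_mult[OF C_const[of c], of f] by (simp add: times_fun_def scaleR_fun_def)

lemma C_uminus: "f \<in> C \<Longrightarrow> - f \<in> C"
  using C_scaleR[of f "-1"] by simp

lemma C_diff: "f \<in> C \<Longrightarrow> h \<in> C \<Longrightarrow> f - h \<in> C"
  using C_add[OF _ C_uminus] by (metis diff_conv_add_uminus)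

lemma C_0: "0 \<in> C" and C_1: "1 \<in> C"
  using C_const[of 0] C_const[of 1] by (simp_all add: zero_fun_def one_fun_def)

lemma C_sum: "(\<And>i. i \<in> I \<Longrightarrow> f i \<in> C) \<Longrightarrow> (\<Sum>i\<in>I. f i) \<in> C"
  by (induction I rule: infinite_finite_induct) (auto intro: C_0 C_add)

text \<open>
Extension by zero from a chart. Away from the compact support the function vanishes; the Hausdorff
property enters because it makes the preimage of the support closed, so that these two descriptions
hold on open sets that cover the manifold.
\<close>

lemma chart_extension_smooth:
  assumes U: "(U, x) \<in> A" and S: "open S" "S \<subseteq> x ` U" and K: "compact K" "K \<subseteq> S"
    and H: "smooth_on S H" "\<And>z. z \<in> S - K \<Longrightarrow> H z = 0"
  shows "(\<lambda>q. if q \<in> U \<and> x q \<in> S then H (x q) else 0) \<in> C"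
  unfolding smooth_functions_iff
proof (intro allI impI)
  fix V y assume V: "(V, y) \<in> A"
  let ?f = "\<lambda>q. if q \<in> U \<and> x q \<in> S then H (x q) else 0"
  let ?W = "{q \<in> U. x q \<in> S}" and ?K = "inv_into U x ` K"
  let ?t = "\<lambda>z. x (inv_into V y z)"
  have "continuous_on K (inv_into U x)"
    using chart_inv_cont[OF U] S K continuous_on_subset by blast
  then have "closed ?K" using K compact_continuous_image compact_imp_closed by blast
  then have open1: "open (y ` (V \<inter> ?W))" and open2: "open (y ` (V \<inter> - ?K))"
    using chart_image_open[OF V] chart_preimage_open[OF U S(1)] by auto
  have "smooth_on (y ` (V \<inter> U)) ?t"
    using atlas U V unfolding smooth_atlas_def by (fastforce simp: comp_def)
  then have t: "smooth_on (y ` (V \<inter> ?W)) ?t"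
    by (rule smooth_on_subset) auto
  have "?t ` y ` (V \<inter> ?W) \<subseteq> S" using chart_inv[OF V] by auto
  from smooth_on_compose[OF open1 S(1) H(1) t this]
  have 1: "smooth_on (y ` (V \<inter> ?W)) (\<lambda>z. ?f (inv_into V y z))"
    by (rule smooth_on_cong[OF open1]) (use chart_inv[OF V] in auto)
  have "?f q = 0" if "q \<notin> ?K" for q
  proof (cases "q \<in> ?W")
    case True
    then have "x q \<notin> K" using that chart_inv[OF U] by (metis (no_types, lifting) image_eqI mem_Collect_eq)
    then show ?thesis using H(2) by auto
  qed auto
  then have 2: "smooth_on (y ` (V \<inter> - ?K)) (\<lambda>z. ?f (inv_into V y z))"
    by (intro smooth_on_cong[OF open2 smooth_on_const[of _ 0]]) (use chart_inv[OF V] in fastforce)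
  have "?K \<subseteq> ?W"
    using K S by (auto simp: f_inv_into_f subset_iff inv_into_into)
  then have "V = (V \<inter> ?W) \<union> (V \<inter> - ?K)" by blast
  then have "y ` V = y ` (V \<inter> ?W) \<union> y ` (V \<inter> - ?K)" by (metis image_Un)
  then show "smooth_on (y ` V) (\<lambda>z. ?f (inv_into V y z))"
    using smooth_on_Un[OF open1 open2 1 2] by simp
qed

lemma cutoff_exists:
  assumes "open N" "p \<in> N"
  obtains \<psi> where "\<psi> \<in> C" "\<psi> p = 1" "\<And>q. q \<notin> N \<Longrightarrow> \<psi> q = 0"
proof -
  obtain U x where U: "(U, x) \<in> A" "p \<in> U" by (rule chart_at)
  let ?S = "x ` (U \<inter> N)"
  have "open ?S" by (rule chart_image_open[OF U(1) assms(1)])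
  then obtain e where e: "e > 0" "cball (x p) e \<subseteq> ?S"
    using open_contains_cball U(2) assms(2) by (metis IntI imageI)
  then obtain \<psi> :: "'e \<Rightarrow> real" where \<psi>: "smooth_on UNIV \<psi>"
      "\<And>z. z \<in> ball (x p) (e / 2) \<Longrightarrow> \<psi> z = 1" "\<And>z. z \<notin> cball (x p) e \<Longrightarrow> \<psi> z = 0"
    using plateau_exists[of "e / 2" "x p"] by auto
  let ?f = "\<lambda>q. if q \<in> U \<and> x q \<in> ?S then \<psi> (x q) else 0"
  show ?thesis
  proof
    show "?f \<in> C"
      by (rule chart_extension_smooth[OF U(1) \<open>open ?S\<close> _ _ e(2)])
        (use \<psi> in \<open>auto intro: smooth_on_subset\<close>)
    show "?f p = 1" using U assms \<psi>(2) e by auto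
    show "?f q = 0" if "q \<notin> N" for q
      using that chart_inj[OF U(1)] by (auto dest: inj_onD)
  qed
qed

lemma tangentD:
  assumes "v \<in> tangent_space A p"
  shows tangent_add: "f \<in> C \<Longrightarrow> h \<in> C \<Longrightarrow> v (f + h) = v f + v h"
    and tangent_scaleR: "f \<in> C \<Longrightarrow> v (c *\<^sub>R f) = c * v f"
    and tangent_mult: "f \<in> C \<Longrightarrow> h \<in> C \<Longrightarrow> v (f * h) = v f * h p + f p * v h"
    and tangent_undef: "f \<notin> C \<Longrightarrow> v f = 0"
  using assms by (auto simp: tangent_space_def linear_on_set_def)

lemma tangent_0: "v \<in> tangent_space A p \<Longrightarrow> v 0 = 0"
  using tangent_scaleR[of v p 0 0] C_0 by simp

lemma tangent_diff:
  assumes "v \<in> tangent_space A p" "f \<in> C" "h \<in> C"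
  shows "v (f - h) = v f - v h"
  using tangent_add[OF assms(1) C_diff[OF assms(2,3)] assms(3)] by simp

lemma tangent_sum:
  assumes "v \<in> tangent_space A p" "\<And>i. i \<in> I \<Longrightarrow> f i \<in> C"
  shows "v (\<Sum>i\<in>I. f i) = (\<Sum>i\<in>I. v (f i))"
  using assms(2)
  by (induction I rule: infinite_finite_induct)
    (auto simp: tangent_0[OF assms(1)] tangent_add[OF assms(1)] C_sum)

lemma tangent_const:
  assumes "v \<in> tangent_space A p"
  shows "v (\<lambda>q. c) = 0"
proof -
  have "v (1 * 1) = v 1 * 1 p + 1 p * v 1" by (rule tangent_mult[OF assms C_1 C_1])
  then have "v 1 = 0" by simp
  moreover have "(\<lambda>q. c) = c *\<^sub>R (1 :: 'a \<Rightarrow> real)" by (simp add: scaleR_fun_def)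
  ultimately show ?thesis using tangent_scaleR[OF assms C_1] by simp
qed

text \<open>
Derivations are local: a cutoff function \<open>\<psi>\<close> annihilates the difference of two functions that agree near \<open>p\<close>,
and the Leibniz rule applied to \<open>\<psi> * (f - h) = 0\<close> gives the claim.
\<close>

lemma tangent_local:
  assumes v: "v \<in> tangent_space A p" and N: "open N" "p \<in> N" and f: "f \<in> C" "h \<in> C"
    and eq: "\<And>q. q \<in> N \<Longrightarrow> f q = h q"
  shows "v f = v h"
proof -
  obtain \<psi> where \<psi>: "\<psi> \<in> C" "\<psi> p = 1" "\<And>q. q \<notin> N \<Longrightarrow> \<psi> q = 0"
    using cutoff_exists[OF N] by blast
  have "\<psi> * (f - h) = 0" using \<psi>(3) eq by (auto simp: fun_eq_iff)
  then have "0 = v (\<psi> * (f - h))" using tangent_0[OF v] by simp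
  also have "\<dots> = v \<psi> * (f - h) p + \<psi> p * v (f - h)"
    by (rule tangent_mult[OF v \<psi>(1) C_diff[OF f]])
  also have "\<dots> = v f - v h"
    using \<psi>(2) eq[OF N(2)] tangent_diff[OF v f] by simp
  finally show ?thesis by simp
qed

lemma subspace_tangent_space: "subspace (tangent_space A p)"
  by (auto simp: subspace_def tangent_space_def linear_on_set_def scaleR_fun_def algebra_simps)

section \<open>Local frames\<close>

text \<open>
The coordinate functions \<open>u b\<close> and the frame fields \<open>E b\<close> are defined on all of the manifold, so that
derivations and connections apply to them; only on \<open>N\<close> are they dual to each other.
\<close>

definition frame_on :: "'a set \<Rightarrow> ('e \<Rightarrow> 'a vfield) \<Rightarrow> ('e \<Rightarrow> 'a \<Rightarrow> real) \<Rightarrow> bool" where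
  "frame_on N E u \<longleftrightarrow> open N \<and> (\<forall>b\<in>Basis. E b \<in> VF \<and> u b \<in> C) \<and>
     (\<forall>q\<in>N. (\<forall>b\<in>Basis. \<forall>c\<in>Basis. E b q (u c) = (if b = c then 1 else 0)) \<and>
            (\<forall>v\<in>tangent_space A q. v = (\<Sum>b\<in>Basis. v (u b) *\<^sub>R E b q)))"

lemma frame_onD:
  assumes "frame_on N E u"
  shows "open N" "b \<in> Basis \<Longrightarrow> E b \<in> VF" "b \<in> Basis \<Longrightarrow> u b \<in> C"
    and "q \<in> N \<Longrightarrow> b \<in> Basis \<Longrightarrow> c \<in> Basis \<Longrightarrow> E b q (u c) = (if b = c then 1 else 0)"
    and "q \<in> N \<Longrightarrow> v \<in> tangent_space A q \<Longrightarrow> v = (\<Sum>b\<in>Basis. v (u b) *\<^sub>R E b q)"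
  using assms unfolding frame_on_def by blast+

text \<open>
A chart times a plateau function gives the \<open>u b\<close> and the coordinate fields \<open>E b\<close>. For the expansion of
a tangent vector at \<open>q\<close>, Hadamard's lemma is applied at \<open>q\<close> and both factors of each product are multiplied by the plateau
function, which turns the local identity into one between globally smooth functions.
\<close>

lemma local_frame: obtains N E u where "p \<in> N" "frame_on N E u"
proof -
  obtain U x where U: "(U, x) \<in> A" "p \<in> U" by (rule chart_at)
  define a where "a = x p"
  obtain e where e: "e > 0" "ball a e \<subseteq> x ` U"
    using chart_open_image[OF U(1)] U(2) unfolding a_def by (metis imageI openE)
  define S where "S = ball a e"
  define K where "K = cball a (2 * (e / 3))"
  have S: "open S" "S \<subseteq> x ` U" "convex S" and K: "compact K" "K \<subseteq> S"
    using e by (auto simp: S_def K_def)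
  obtain \<rho> :: "'e \<Rightarrow> real" where \<rho>: "smooth_on UNIV \<rho>"
      "\<And>z. z \<in> ball a (e / 3) \<Longrightarrow> \<rho> z = 1" "\<And>z. z \<notin> K \<Longrightarrow> \<rho> z = 0"
    unfolding K_def using plateau_exists[of "e / 3" a] e(1) by auto
  define N where "N = {q \<in> U. x q \<in> ball a (e / 3)}"
  have N_S: "x q \<in> S" "q \<in> U" "\<rho> (x q) = 1" "x q \<in> ball a (e / 3)" if "q \<in> N" for q
    using that e(1) \<rho>(2) by (auto simp: N_def S_def)
  have ball_S: "ball a (e / 3) \<subseteq> S" using e(1) by (auto simp: S_def)
  define ext where "ext = (\<lambda>H q. if q \<in> U \<and> x q \<in> S then \<rho> (x q) * H (x q) else (0::real))"
  have ext_C: "ext H \<in> C" if "smooth_on S H" for H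
    unfolding ext_def
    by (rule chart_extension_smooth[OF U(1) S(1,2) K])
      (use \<rho> that in \<open>auto intro: smooth_on_mult S smooth_on_subset\<close>)
  have ext_N: "ext H q = H (x q)" if "q \<in> N" for H q
    using N_S[OF that] by (simp add: ext_def)
  define loc where "loc = (\<lambda>f z. (f :: 'a \<Rightarrow> real) (inv_into U x z))"
  have loc: "smooth_on S (loc f)" if "f \<in> C" for f
    unfolding loc_def using smooth_functionsD[OF that U(1)] S(2) by (rule smooth_on_subset)
  have loc_x: "loc f (x q) = f q" if "q \<in> U" for f q
    using chart_inv[OF U(1) that] by (simp add: loc_def)
  define d where "d = (\<lambda>f z. frechet_derivative (loc f) (at z))"
  have d: "(loc f has_derivative d f z) (at z)" if "f \<in> C" "z \<in> S" for f z
    unfolding d_def by (rule smooth_on_has_derivative[OF loc[OF that(1)] that(2)])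
  have d_eq: "d f z = D" if "(loc f has_derivative D) (at z)" for f z D
    unfolding d_def using frechet_derivative_at[OF that] by simp
  have d_eq_N: "d f (x q) = D"
    if "q \<in> N" "(h has_derivative D) (at (x q))" "\<And>q. q \<in> N \<Longrightarrow> f q = h (x q)" for f h q D
  proof (rule d_eq)
    show "(loc f has_derivative D) (at (x q))"
    proof (rule has_derivative_transform_within_open[OF that(2)])
      show "open (ball a (e / 3))" "x q \<in> ball a (e / 3)" using N_S[OF that(1)] by auto
      fix z assume "z \<in> ball a (e / 3)"
      moreover obtain q' where "q' \<in> U" "z = x q'" using calculation ball_S S(2) by blast
      ultimately have "q' \<in> N" "z = x q'" by (auto simp: N_def)
      then show "h z = loc f z" using that(3) loc_x \<open>q' \<in> U\<close> by simp
    qed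
  qed
  define u where "u = (\<lambda>b. ext (\<lambda>z. z \<bullet> b))"
  define E where "E = (\<lambda>b q f. if f \<in> C then ext (\<lambda>z. d f z b) q else 0)"
  have u_C: "u b \<in> C" for b
    unfolding u_def
    by (intro ext_C smooth_on_bounded_linear[OF S(1) bounded_linear_inner_left] smooth_on_id S(1))
  have E_VF: "E b \<in> VF" for b
    unfolding vector_fields_def
  proof (intro CollectI conjI allI ballI)
    show "(\<lambda>q. E b q f) \<in> C" if "f \<in> C" for f
      using ext_C[OF smooth_on_frechet_derivative[OF loc[OF that]], of b] that
      by (simp add: E_def d_def)
    show "E b q \<in> tangent_space A q" for q
    proof (cases "q \<in> U \<and> x q \<in> S")
      case False
      then have "E b q = 0" by (auto simp: E_def ext_def fun_eq_iff)
      then show ?thesis using subspace_0[OF subspace_tangent_space] by simp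
    next
      case True
      then have q: "q \<in> U" "x q \<in> S" by auto
      have add: "d (f + h) (x q) b = d f (x q) b + d h (x q) b" if "f \<in> C" "h \<in> C" for f h
      proof -
        have "(loc (f + h) has_derivative (\<lambda>v. d f (x q) v + d h (x q) v)) (at (x q))"
          using has_derivative_add[OF d[OF that(1) q(2)] d[OF that(2) q(2)]] by (simp add: loc_def)
        then show ?thesis by (simp add: d_eq)
      qed
      have mult: "d (f * h) (x q) b = d f (x q) b * h q + f q * d h (x q) b"
        if "f \<in> C" "h \<in> C" for f h
      proof -
        have "(loc (f * h) has_derivative
            (\<lambda>v. loc f (x q) * d h (x q) v + d f (x q) v * loc h (x q))) (at (x q))"
          using has_derivative_mult[OF d[OF that(1) q(2)] d[OF that(2) q(2)]] by (simp add: loc_def)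
        then show ?thesis by (simp add: d_eq loc_x q)
      qed
      have scale: "d (r *\<^sub>R f) (x q) b = r * d f (x q) b" if "f \<in> C" for f r
      proof -
        have "(loc (r *\<^sub>R f) has_derivative (\<lambda>v. r *\<^sub>R d f (x q) v)) (at (x q))"
          using has_derivative_scaleR_right[OF d[OF that q(2)], of r]
          by (simp add: loc_def scaleR_fun_def)
        then show ?thesis by (simp add: d_eq)
      qed
      show ?thesis
        using q by (auto simp: tangent_space_def linear_on_set_def E_def ext_def add mult scale
            C_add C_mult C_scaleR algebra_simps)
    qed
  qed
  have star: "v f = (\<Sum>b\<in>Basis. v (ext (\<lambda>z. (z - x q) \<bullet> b)) * d f (x q) b)"
    if q: "q \<in> N" and v: "v \<in> tangent_space A q" and f: "f \<in> C" for q v f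
  proof -
    note q' = N_S[OF q]
    obtain G where G: "\<And>b. smooth_on S (G b)" "\<And>b. G b (x q) = d f (x q) b"
      "\<And>y. y \<in> S \<Longrightarrow> loc f y = loc f (x q) + (\<Sum>b\<in>Basis. ((y - x q) \<bullet> b) * G b y)"
      using hadamard[OF S(1,3) q'(1) loc[OF f]] unfolding d_def by blast
    let ?c = "ext (\<lambda>z. 1)" and ?h = "f - (\<lambda>_. f q)"
    let ?l = "\<lambda>b. ext (\<lambda>z. (z - x q) \<bullet> b)" and ?g = "\<lambda>b. ext (G b)"
    have c: "?c \<in> C" and h: "?h \<in> C" using ext_C smooth_on_const C_diff f C_const by blast+
    have l: "?l b \<in> C" for b
    proof (rule ext_C)
      have "smooth_on S (\<lambda>z. z \<bullet> b + - (x q \<bullet> b))"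
        by (intro smooth_on_add S(1) smooth_on_const
            smooth_on_bounded_linear[OF _ bounded_linear_inner_left] smooth_on_id)
      then show "smooth_on S (\<lambda>z. (z - x q) \<bullet> b)" by (simp add: inner_diff_left)
    qed
    have g: "?g b \<in> C" for b by (rule ext_C[OF G(1)])
    \<comment> \<open>At \<open>q\<close> the plateau function is \<open>1\<close> and \<open>f - f q\<close> vanishes, so \<open>v\<close> takes the same value on this product as on \<open>f\<close>.\<close>
    have prod: "?c * ?c * ?h = (\<Sum>b\<in>Basis. ?l b * ?g b)"
    proof
      fix q2
      show "(?c * ?c * ?h) q2 = (\<Sum>b\<in>Basis. ?l b * ?g b) q2"
      proof (cases "q2 \<in> U \<and> x q2 \<in> S")
        case True
        then have "f q2 - f q = (\<Sum>b\<in>Basis. ((x q2 - x q) \<bullet> b) * G b (x q2))"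
          using G(3)[of "x q2"] loc_x q'(2) by simp
        then show ?thesis using True
          by (simp add: sum_fun_apply ext_def sum_distrib_left mult_ac)
      qed (auto simp: sum_fun_apply ext_def)
    qed
    have "v (?c * ?c * ?h) = v (?c * ?c) * ?h q + (?c * ?c) q * v ?h"
      by (rule tangent_mult[OF v C_mult[OF c c] h])
    also have "\<dots> = v f"
      using ext_N[OF q] tangent_diff[OF v f C_const] tangent_const[OF v] by simp
    finally have "v f = v (\<Sum>b\<in>Basis. ?l b * ?g b)" using prod by simp
    also have "\<dots> = (\<Sum>b\<in>Basis. v (?l b) * ?g b q + ?l b q * v (?g b))"
      by (simp add: tangent_sum[OF v] C_mult l g tangent_mult[OF v l g])
    also have "\<dots> = (\<Sum>b\<in>Basis. v (?l b) * d f (x q) b)"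
      using ext_N[OF q] G(2) by simp
    finally show ?thesis .
  qed
  \<comment> \<open>Centering the coordinates at \<open>q\<close> is immaterial: plateau functions are constant near \<open>q\<close>, so \<open>star\<close> shows that \<open>v\<close> annihilates them.\<close>
  have coord: "v (ext (\<lambda>z. (z - x q) \<bullet> b)) = v (u b)"
    if q: "q \<in> N" and v: "v \<in> tangent_space A q" for q v b
  proof -
    let ?c = "ext (\<lambda>z. 1)"
    have c: "?c \<in> C" by (rule ext_C[OF smooth_on_const])
    have "d ?c (x q) = (\<lambda>v. 0)"
      by (rule d_eq_N[OF q has_derivative_const[of 1]]) (rule ext_N)
    then have "v ?c = 0" using star[OF q v c] by simp
    moreover have "ext (\<lambda>z. (z - x q) \<bullet> b) = u b - (x q \<bullet> b) *\<^sub>R ?c"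
      by (auto simp: fun_eq_iff u_def ext_def scaleR_fun_def inner_diff_left algebra_simps)
    ultimately show ?thesis
      using tangent_diff[OF v u_C C_scaleR[OF c]] tangent_scaleR[OF v c] by simp
  qed
  have "frame_on N E u"
    unfolding frame_on_def
  proof (intro conjI ballI)
    show "open N" unfolding N_def by (rule chart_preimage_open[OF U(1)]) simp
    show "E b \<in> VF" "u b \<in> C" for b by (rule E_VF u_C)+
    show "E b q (u c) = (if b = c then 1 else 0)" if "q \<in> N" "b \<in> Basis" "c \<in> Basis" for q b c
    proof -
      have "d (u c) (x q) = (\<lambda>v. v \<bullet> c)"
        by (rule d_eq_N[OF that(1) bounded_linear_imp_has_derivative[OF bounded_linear_inner_left]])
          (simp add: u_def ext_N)
      then show ?thesis using u_C ext_N[OF that(1)] inner_Basis[OF that(2,3)] by (simp add: E_def)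
    qed
    show "v = (\<Sum>b\<in>Basis. v (u b) *\<^sub>R E b q)" if q: "q \<in> N" and v: "v \<in> tangent_space A q" for q v
    proof
      fix f
      show "v f = (\<Sum>b\<in>Basis. v (u b) *\<^sub>R E b q) f"
        using star[OF q v, of f] tangent_undef[OF v, of f] coord[OF q v] ext_N[OF q]
        by (cases "f \<in> C") (simp_all add: sum_fun_apply scaleR_fun_def E_def)
    qed
  qed
  moreover have "p \<in> N" using U(2) e(1) by (simp add: N_def a_def)
  ultimately show ?thesis using that by blast
qed

end

text \<open>
The trace is defined with an arbitrarily chosen basis \<open>B\<close>. Expanding each \<open>b\<close> in \<open>B\<close> in terms of the \<open>E i\<close>
and each \<open>w i\<close> in terms of \<open>B\<close> turns the trace into a sum that no longer mentions \<open>B\<close>.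
\<close>

lemma trace_on_frame:
  fixes S :: "'v::real_vector set"
  assumes "subspace S" "finite I" "\<And>i. i \<in> I \<Longrightarrow> linear (\<kappa> i)" "\<And>i. i \<in> I \<Longrightarrow> w i \<in> S"
    and frame: "\<And>v. v \<in> S \<Longrightarrow> v = (\<Sum>i\<in>I. \<kappa> i v *\<^sub>R E i)"
    and T: "\<And>v. v \<in> S \<Longrightarrow> T v = (\<Sum>i\<in>I. \<kappa> i v *\<^sub>R w i)"
  shows "trace_on S T = (\<Sum>i\<in>I. \<kappa> i (w i))"
proof -
  obtain B0 where "B0 \<subseteq> S" "independent B0" "S \<subseteq> span B0"
    using basis_exists[of S] by metis
  then have ex: "\<exists>B. B \<subseteq> S \<and> independent B \<and> S \<subseteq> span B" by blast
  define B where "B = (SOME B. B \<subseteq> S \<and> independent B \<and> S \<subseteq> span B)"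
  have B: "B \<subseteq> S" "independent B" "S \<subseteq> span B"
    using someI_ex[OF ex] unfolding B_def by blast+
  have tr: "trace_on S T = (\<Sum>b\<in>B. representation B (T b) b)"
    by (simp add: trace_on_def Let_def B_def)
  have "v \<in> span (E ` I)" if "v \<in> S" for v
    by (subst frame[OF that]) (intro span_sum span_scale span_base imageI)
  then have "finite B"
    using independent_span_bound[of "E ` I" B] B assms(2) by blast
  have w: "w i \<in> span B" if "i \<in> I" for i using assms(4)[OF that] B(3) by blast
  have "(\<Sum>b\<in>B. representation B (T b) b) = (\<Sum>b\<in>B. \<Sum>i\<in>I. \<kappa> i b * representation B (w i) b)"
  proof (rule sum.cong[OF refl])
    fix b assume "b \<in> B"
    then have "T b = (\<Sum>i\<in>I. \<kappa> i b *\<^sub>R w i)" using B T by blast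
    then show "representation B (T b) b = (\<Sum>i\<in>I. \<kappa> i b * representation B (w i) b)"
      by (simp add: representation_sum[OF B(2)] representation_scale[OF B(2)] span_scale w)
  qed
  also have "\<dots> = (\<Sum>i\<in>I. \<Sum>b\<in>B. \<kappa> i (representation B (w i) b *\<^sub>R b))"
    by (subst sum.swap) (simp add: linear_cmul[OF assms(3)] mult.commute)
  also have "\<dots> = (\<Sum>i\<in>I. \<kappa> i (\<Sum>b\<in>B. representation B (w i) b *\<^sub>R b))"
    by (simp add: linear_sum[OF assms(3)])
  also have "\<dots> = (\<Sum>i\<in>I. \<kappa> i (w i))"
    by (simp add: sum_representation_eq[OF B(2) w \<open>finite B\<close>])
  finally show ?thesis using tr by simp
qed

section \<open>The Lie algebra of vector fields\<close>

abbreviation (input) "dd \<equiv> dir_deriv"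

context smooth_manifold
begin

abbreviation "br \<equiv> lie_bracket A"

lemma C_pointwise [simp]:
  shows "(\<lambda>p. c) \<in> C"
    and "f \<in> C \<Longrightarrow> h \<in> C \<Longrightarrow> (\<lambda>p. f p + h p) \<in> C"
    and "f \<in> C \<Longrightarrow> h \<in> C \<Longrightarrow> (\<lambda>p. f p * h p) \<in> C"
    and "f \<in> C \<Longrightarrow> (\<lambda>p. - f p) \<in> C"
    and "f \<in> C \<Longrightarrow> h \<in> C \<Longrightarrow> (\<lambda>p. f p - h p) \<in> C"
  by (fact C_const C_add[unfolded plus_fun_def] C_mult[unfolded times_fun_def]
      C_uminus[unfolded fun_Compl_def] C_diff[unfolded fun_diff_def])+

lemma VF_tangent [simp]: "X \<in> VF \<Longrightarrow> X p \<in> tangent_space A p"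
  by (simp add: vector_fields_def)

lemma dd_C [simp]: "X \<in> VF \<Longrightarrow> f \<in> C \<Longrightarrow> dd X f \<in> C"
  by (simp add: vector_fields_def dir_deriv_def del: VF_tangent)

lemma dd_const [simp]: "X \<in> VF \<Longrightarrow> dd X (\<lambda>p. c) = (\<lambda>p. 0)"
  using tangent_const[OF VF_tangent] by (auto simp: dir_deriv_def)

lemma dd_function [simp]:
  assumes "X \<in> VF" "f \<in> C" "h \<in> C"
  shows dd_add: "dd X (\<lambda>p. f p + h p) = (\<lambda>p. dd X f p + dd X h p)"
    and dd_diff: "dd X (\<lambda>p. f p - h p) = (\<lambda>p. dd X f p - dd X h p)"
    and dd_mult: "dd X (\<lambda>p. f p * h p) = (\<lambda>p. dd X f p * h p + f p * dd X h p)"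
  using tangent_add[OF VF_tangent[OF assms(1)] assms(2,3), unfolded plus_fun_def]
    tangent_diff[OF VF_tangent[OF assms(1)] assms(2,3), unfolded fun_diff_def]
    tangent_mult[OF VF_tangent[OF assms(1)] assms(2,3), unfolded times_fun_def]
  unfolding dir_deriv_def by blast+

lemma dd_uminus [simp]:
  assumes "X \<in> VF" "f \<in> C"
  shows "dd X (\<lambda>p. - f p) = (\<lambda>p. - dd X f p)"
  using dd_diff[OF assms(1) C_const[of 0] assms(2)] assms by simp

lemma dd_vector [simp]:
  fixes X Y :: "'a vfield"
  shows "dd (X + Y) f = (\<lambda>p. dd X f p + dd Y f p)"
    and "dd (X - Y) f = (\<lambda>p. dd X f p - dd Y f p)"
    and "dd (- X) f = (\<lambda>p. - dd X f p)"
    and "dd 0 f = (\<lambda>p. 0)"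
    and "dd (fmul h X) f = (\<lambda>p. h p * dd X f p)"
  by (simp_all add: dir_deriv_def fmul_def scaleR_fun_def)

lemma dd_br: "f \<in> C \<Longrightarrow> dd (br X Y) f = (\<lambda>p. dd X (dd Y f) p - dd Y (dd X f) p)"
  by (simp add: dir_deriv_def lie_bracket_def)

lemma VF_eqI:
  assumes "X \<in> VF" "Y \<in> VF" "\<And>f p. f \<in> C \<Longrightarrow> dd X f p = dd Y f p"
  shows "X = Y"
proof (intro ext)
  fix p f
  show "X p f = Y p f"
    using assms(3)[of f p] tangent_undef[OF VF_tangent[OF assms(1)]]
      tangent_undef[OF VF_tangent[OF assms(2)]]
    by (cases "f \<in> C") (auto simp: dir_deriv_def)
qed

lemma VF_closed [simp]:
  shows VF_0: "0 \<in> VF"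
    and VF_add: "X \<in> VF \<Longrightarrow> Y \<in> VF \<Longrightarrow> X + Y \<in> VF"
    and VF_fmul: "f \<in> C \<Longrightarrow> X \<in> VF \<Longrightarrow> fmul f X \<in> VF"
    and VF_uminus: "X \<in> VF \<Longrightarrow> - X \<in> VF"
    and VF_diff: "X \<in> VF \<Longrightarrow> Y \<in> VF \<Longrightarrow> X - Y \<in> VF"
proof -
  have VFI: "X \<in> VF" if "\<And>p. X p \<in> tangent_space A p" "\<And>f. f \<in> C \<Longrightarrow> dd X f \<in> C" for X
    using that by (simp add: vector_fields_def dir_deriv_def del: VF_tangent)
  note ss = subspace_tangent_space
  show "0 \<in> VF" by (rule VFI) (auto intro: subspace_0[OF ss])
  show *: "X + Y \<in> VF" if "X \<in> VF" "Y \<in> VF" for X Y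
    using that by (intro VFI) (auto intro: subspace_add[OF ss])
  show **: "fmul f X \<in> VF" if "f \<in> C" "X \<in> VF" for f X
  proof (rule VFI)
    show "fmul f X p \<in> tangent_space A p" for p
      using subspace_scale[OF ss VF_tangent[OF that(2)]] by (simp add: fmul_def)
  qed (use that in simp)
  show ***: "- X \<in> VF" if "X \<in> VF" for X
    using that by (intro VFI) (auto intro: subspace_neg[OF ss])
  show "X - Y \<in> VF" if "X \<in> VF" "Y \<in> VF" for X Y
    using *[OF that(1) ***[OF that(2)]] by simp
qed

lemma VF_sum: "(\<And>i. i \<in> I \<Longrightarrow> X i \<in> VF) \<Longrightarrow> (\<Sum>i\<in>I. X i) \<in> VF"
  by (induction I rule: infinite_finite_induct) auto

lemma VF_br [simp]:
  assumes "X \<in> VF" "Y \<in> VF"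
  shows "br X Y \<in> VF"
proof -
  have "br X Y p \<in> tangent_space A p" for p
    unfolding tangent_space_def linear_on_set_def
  proof (intro CollectI conjI ballI allI impI)
    fix f h assume f: "f \<in> C" "h \<in> C"
    have "dd (br X Y) (\<lambda>p. f p + h p) p = dd (br X Y) f p + dd (br X Y) h p"
      using assms f by (simp add: dd_br)
    then show "br X Y p (f + h) = br X Y p f + br X Y p h"
      by (simp add: dir_deriv_def plus_fun_def)
    have "dd (br X Y) (\<lambda>p. f p * h p) p = dd (br X Y) f p * h p + f p * dd (br X Y) h p"
      using assms f by (simp add: dd_br algebra_simps)
    then show "br X Y p (f * h) = br X Y p f * h p + f p * br X Y p h"
      by (simp add: dir_deriv_def times_fun_def)
  next
    fix f r assume f: "f \<in> C"
    have "dd (br X Y) (\<lambda>p. r * f p) p = r * dd (br X Y) f p"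
      using assms f by (simp add: dd_br algebra_simps)
    then show "br X Y p (r *\<^sub>R f) = r *\<^sub>R br X Y p f"
      by (simp add: dir_deriv_def scaleR_fun_def)
  qed (simp add: lie_bracket_def)
  moreover have "(\<lambda>p. br X Y p f) \<in> C" if "f \<in> C" for f
    using dd_br[OF that, of X Y] assms that by (simp add: dir_deriv_def[of "br X Y"])
  ultimately show ?thesis by (simp add: vector_fields_def del: VF_tangent)
qed

lemma br_diff: "X \<in> VF \<Longrightarrow> Y \<in> VF \<Longrightarrow> Z \<in> VF \<Longrightarrow> br X (Y - Z) = br X Y - br X Z"
  by (rule VF_eqI) (simp_all add: dd_br)

lemma br_add_left: "X \<in> VF \<Longrightarrow> Y \<in> VF \<Longrightarrow> Z \<in> VF \<Longrightarrow> br (X + Y) Z = br X Z + br Y Z"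
  by (rule VF_eqI) (simp_all add: dd_br)

lemma br_fmul_left:
  "f \<in> C \<Longrightarrow> X \<in> VF \<Longrightarrow> Y \<in> VF \<Longrightarrow> br (fmul f X) Y = fmul f (br X Y) - fmul (dd Y f) X"
  by (rule VF_eqI) (simp_all add: dd_br algebra_simps)

lemma br_minus_swap: "X \<in> VF \<Longrightarrow> Y \<in> VF \<Longrightarrow> br X Y = - br Y X"
  by (rule VF_eqI) (simp_all add: dd_br)

lemma br_jacobi:
  "X \<in> VF \<Longrightarrow> Y \<in> VF \<Longrightarrow> Z \<in> VF \<Longrightarrow> br X (br Y Z) = br (br X Y) Z + br Y (br X Z)"
  by (rule VF_eqI) (simp_all add: dd_br)

text \<open>
The Lie derivative along \<open>W\<close> of a covariant 2-tensor, as the tensor derivation that extends \<open>W\<close> on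
functions and \<open>[W, _]\<close> on fields. It is defined for arbitrary \<open>B\<close>, so that it can be iterated.
\<close>

definition Lie :: "('a vfield \<Rightarrow> 'a vfield \<Rightarrow> 'a \<Rightarrow> real) \<Rightarrow> 'a vfield \<Rightarrow> 'a vfield \<Rightarrow> 'a vfield \<Rightarrow> 'a \<Rightarrow> real"
  where "Lie B W X Y = (\<lambda>p. dd W (B X Y) p - B (br W X) Y p - B X (br W Y) p)"

lemma Lie_cong:
  assumes "\<And>X Y. X \<in> VF \<Longrightarrow> Y \<in> VF \<Longrightarrow> B X Y = B' X Y" "W \<in> VF" "X \<in> VF" "Y \<in> VF"
  shows "Lie B W X Y = Lie B' W X Y"
  using assms by (simp add: Lie_def)

lemma Lie_bracket:
  assumes B: "\<And>X Y. X \<in> VF \<Longrightarrow> Y \<in> VF \<Longrightarrow> B X Y \<in> C"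
    "\<And>X Y Z. X \<in> VF \<Longrightarrow> Y \<in> VF \<Longrightarrow> Z \<in> VF \<Longrightarrow> B (X - Y) Z = (\<lambda>p. B X Z p - B Y Z p)"
    "\<And>X Y Z. X \<in> VF \<Longrightarrow> Y \<in> VF \<Longrightarrow> Z \<in> VF \<Longrightarrow> B Z (X - Y) = (\<lambda>p. B Z X p - B Z Y p)"
    and W: "W \<in> VF" "Z \<in> VF" "X \<in> VF" "Y \<in> VF"
  shows "Lie B (br W Z) X Y p = Lie (Lie B Z) W X Y p - Lie (Lie B W) Z X Y p"
proof -
  have j: "br (br W Z) X' = br W (br Z X') - br Z (br W X')" if "X' \<in> VF" for X'
    using br_jacobi[OF W(1,2) that] by simp
  show ?thesis
    unfolding Lie_def j[OF W(3)] j[OF W(4)]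
    using W by (simp add: B dd_br)
qed

text \<open>
A map that is linear over smooth functions is determined pointwise. Multiplying by a cutoff function
\<open>\<psi>\<close> makes the expansion of \<open>X\<close> in the frame valid globally, and \<open>\<psi>\<close> drops out at \<open>q\<close>.
\<close>

lemma tensor_local_frame:
  assumes frame: "frame_on N E u"
    and F: "\<And>X Y. X \<in> VF \<Longrightarrow> Y \<in> VF \<Longrightarrow> F (X + Y) = F X + F Y"
      "\<And>f X. f \<in> C \<Longrightarrow> X \<in> VF \<Longrightarrow> F (fmul f X) = fmul f (F X)"
    and X: "X \<in> VF" and q: "q \<in> N"
  shows "F X q = (\<Sum>b\<in>Basis. X q (u b) *\<^sub>R F (E b) q)"
proof -
  let ?I = "Basis :: 'e set"
  note E = frame_onD(2)[OF frame] and u = frame_onD(3)[OF frame]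
  obtain \<psi> where \<psi>: "\<psi> \<in> C" "\<psi> q = 1" "\<And>p. p \<notin> N \<Longrightarrow> \<psi> p = 0"
    using cutoff_exists[OF frame_onD(1)[OF frame] q] by blast
  let ?c = "\<lambda>b p. \<psi> p * dd X (u b) p"
  have c: "?c b \<in> C" if "b \<in> ?I" for b using \<psi>(1) X u[OF that] by simp
  have "fmul \<psi> X = (\<Sum>b\<in>?I. fmul (?c b) (E b))"
  proof
    fix p
    show "fmul \<psi> X p = (\<Sum>b\<in>?I. fmul (?c b) (E b)) p"
    proof (cases "p \<in> N")
      case True
      have "fmul \<psi> X p = \<psi> p *\<^sub>R (\<Sum>b\<in>?I. X p (u b) *\<^sub>R E b p)"
        using frame_onD(5)[OF frame True VF_tangent[OF X, of p]] by (simp only: fmul_def)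
      then show ?thesis
        by (simp add: sum_fun_apply fmul_def scaleR_sum_right dir_deriv_def)
    next
      case False
      then show ?thesis by (simp add: sum_fun_apply fmul_def \<psi>(3))
    qed
  qed
  moreover have F0: "F 0 = 0" using F(1)[OF VF_0 VF_0] by simp
  have "F (\<Sum>b\<in>J. fmul (?c b) (E b)) = (\<Sum>b\<in>J. fmul (?c b) (F (E b)))" if "J \<subseteq> ?I" for J
    using that
  proof (induction J rule: infinite_finite_induct)
    case (insert b J)
    have "(\<Sum>b\<in>J. fmul (?c b) (E b)) \<in> VF" using insert c E by (intro VF_sum VF_fmul) auto
    moreover have b: "?c b \<in> C" "E b \<in> VF" using insert c E by auto
    ultimately have "F (fmul (?c b) (E b) + (\<Sum>b\<in>J. fmul (?c b) (E b)))
        = fmul (?c b) (F (E b)) + (\<Sum>b\<in>J. fmul (?c b) (F (E b)))"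
      using insert.IH insert.prems by (subst F(1)) (simp_all only: F(2) VF_fmul insert_subset)
    then show ?case unfolding sum.insert[OF insert.hyps] .
  next
    case empty
    show ?case using F0 by (simp only: sum.empty)
  next
    case (infinite J)
    show ?case using F0 unfolding sum.infinite[OF infinite.hyps] .
  qed
  ultimately have "fmul \<psi> (F X) = (\<Sum>b\<in>?I. fmul (?c b) (F (E b)))"
    using F(2)[OF \<psi>(1) X] by simp
  from fun_cong[OF this, of q] show ?thesis
    using \<psi>(2) by (simp add: sum_fun_apply fmul_def dir_deriv_def)
qed

lemma vector_field_through:
  assumes "v \<in> tangent_space A p"
  obtains X where "X \<in> VF" "X p = v"
proof -
  obtain N E u where N: "p \<in> N" and fr: "frame_on N E u" by (rule local_frame)
  show ?thesis
  proof
    show "(\<Sum>b\<in>(Basis :: 'e set). fmul (\<lambda>_. v (u b)) (E b)) \<in> VF"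
      using frame_onD(2)[OF fr] by (intro VF_sum VF_fmul) auto
    show "(\<Sum>b\<in>(Basis :: 'e set). fmul (\<lambda>_. v (u b)) (E b)) p = v"
      using frame_onD(5)[OF fr N assms] by (simp add: sum_fun_apply fmul_def)
  qed
qed

end

section \<open>Kenmotsu structures\<close>

lemma linear_on_set_diff:
  assumes "subspace S" "linear_on_set S T" "u \<in> S" "v \<in> S"
  shows "T (u - v) = T u - T v"
proof -
  have "T (u - v + v) = T (u - v) + T v"
    using assms subspace_diff[OF assms(1,3,4)] unfolding linear_on_set_def by blast
  then show ?thesis by simp
qed

lemma linear_on_set_sum:
  assumes "subspace S" "linear_on_set S T" "finite I" "\<And>i. i \<in> I \<Longrightarrow> v i \<in> S"
  shows "T (\<Sum>i\<in>I. c i *\<^sub>R v i) = (\<Sum>i\<in>I. c i *\<^sub>R T (v i))"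
  using assms(3,4)
proof (induction I rule: finite_induct)
  case empty
  have "T (0 *\<^sub>R 0) = 0 *\<^sub>R T 0"
    using assms(2) subspace_0[OF assms(1)] unfolding linear_on_set_def by blast
  then show ?case by simp
next
  case (insert i I)
  have "c i *\<^sub>R v i \<in> S" "(\<Sum>i\<in>I. c i *\<^sub>R v i) \<in> S" "v i \<in> S"
    using insert.prems assms(1) by (auto intro!: subspace_sum subspace_scale)
  then have "T (c i *\<^sub>R v i + (\<Sum>i\<in>I. c i *\<^sub>R v i)) = c i *\<^sub>R T (v i) + T (\<Sum>i\<in>I. c i *\<^sub>R v i)"
    using assms(2) unfolding linear_on_set_def by metis
  then show ?case using insert by simp
qed

locale kenmotsu_manifold = smooth_manifold A
  for A :: "('a::t2_space, 'e::euclidean_space) chart set" +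
  fixes \<phi> :: "'a endo_field" and \<xi> :: "'a vfield" and \<eta> :: "'a one_form"
    and g :: "'a bilinear_field" and D :: "'a connection" and \<epsilon> :: real
  assumes kenmotsu: "kenmotsu_pseudo_metric A D \<phi> \<xi> \<eta> g \<epsilon>"
begin

abbreviation "G \<equiv> app2 g"
abbreviation "e \<equiv> app \<eta>"
abbreviation "R \<equiv> curvature A D"

lemma structure_facts:
  shows phi: "\<phi> \<in> endo_fields A" and xi [simp]: "\<xi> \<in> VF" and eta: "\<eta> \<in> one_forms A"
    and metric: "pseudo_riemannian_metric A g" and eps: "\<epsilon> = 1 \<or> \<epsilon> = -1"
    and phi_phi: "X \<in> VF \<Longrightarrow> app \<phi> (app \<phi> X) = - X + fmul (e X) \<xi>"
    and e_xi [simp]: "e \<xi> = (\<lambda>p. 1)" and phi_xi: "app \<phi> \<xi> = 0"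
    and G_phi: "X \<in> VF \<Longrightarrow> Y \<in> VF \<Longrightarrow>
      G (app \<phi> X) (app \<phi> Y) = G X Y - \<epsilon> *\<^sub>R (e X * e Y)"
    and levi_civita: "levi_civita_connection A g D"
    and nabla_phi: "X \<in> VF \<Longrightarrow> Y \<in> VF \<Longrightarrow> cov_deriv_endo D \<phi> X Y =
      - fmul (e Y) (app \<phi> X) - fmul (\<epsilon> *\<^sub>R G X (app \<phi> Y)) \<xi>"
  using kenmotsu
  by (auto simp: kenmotsu_pseudo_metric_def almost_contact_pseudo_metric_def one_fun_def)

lemma eps_sq [simp]: "\<epsilon> * \<epsilon> = 1" "\<epsilon> * (\<epsilon> * x) = x"
  using eps by auto

lemma G_C [simp]: "X \<in> VF \<Longrightarrow> Y \<in> VF \<Longrightarrow> G X Y \<in> C"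
  using metric by (simp add: pseudo_riemannian_metric_def)

lemma G_linear_at: "v \<in> tangent_space A p \<Longrightarrow> linear_on_set (tangent_space A p) (g p v)"
  using metric by (simp add: pseudo_riemannian_metric_def)

lemma G_sym: "X \<in> VF \<Longrightarrow> Y \<in> VF \<Longrightarrow> G X Y = G Y X"
  using metric by (auto simp: pseudo_riemannian_metric_def app2_def)

lemma G_right [simp]:
  assumes "X \<in> VF" "Y \<in> VF" "Z \<in> VF"
  shows "G X (Y + Z) = (\<lambda>p. G X Y p + G X Z p)"
    and "G X (Y - Z) = (\<lambda>p. G X Y p - G X Z p)"
    and "G X (fmul f Y) = (\<lambda>p. f p * G X Y p)"
proof -
  note lin = G_linear_at[OF VF_tangent[OF assms(1)]]
  show "G X (Y + Z) = (\<lambda>p. G X Y p + G X Z p)" "G X (fmul f Y) = (\<lambda>p. f p * G X Y p)"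
    using lin assms by (auto simp: app2_def fmul_def linear_on_set_def)
  show "G X (Y - Z) = (\<lambda>p. G X Y p - G X Z p)"
    using linear_on_set_diff[OF subspace_tangent_space lin] assms by (auto simp: app2_def)
qed

lemma G_left [simp]:
  assumes "X \<in> VF" "Y \<in> VF" "Z \<in> VF"
  shows "G (X + Y) Z = (\<lambda>p. G X Z p + G Y Z p)"
    and "G (X - Y) Z = (\<lambda>p. G X Z p - G Y Z p)"
    and "f \<in> C \<Longrightarrow> G (fmul f X) Z = (\<lambda>p. f p * G X Z p)"
  using assms by (simp_all add: G_sym[of _ Z])

lemma G_nondegenerate:
  assumes "X \<in> VF" "Y \<in> VF" "\<And>Z p. Z \<in> VF \<Longrightarrow> G X Z p = G Y Z p"
  shows "X = Y"
proof
  fix p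
  have "g p (X p - Y p) w = 0" if w: "w \<in> tangent_space A p" for w
  proof -
    obtain Z where Z: "Z \<in> VF" "Z p = w" using vector_field_through[OF w] by blast
    have "G (X - Y) Z p = 0" using assms Z by simp
    then show ?thesis using Z by (simp add: app2_def)
  qed
  moreover have "X p - Y p \<in> tangent_space A p"
    using VF_tangent[OF VF_diff[OF assms(1,2)], of p] by simp
  ultimately have "X p - Y p = 0"
    using metric unfolding pseudo_riemannian_metric_def by blast
  then show "X p = Y p" by simp
qed

lemma e_C [simp]: "X \<in> VF \<Longrightarrow> e X \<in> C"
  using eta by (simp add: one_forms_def)

lemma e_linear [simp]:
  assumes "X \<in> VF" "Y \<in> VF"
  shows "e (X + Y) = (\<lambda>p. e X p + e Y p)"
    and "e (X - Y) = (\<lambda>p. e X p - e Y p)"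
    and "e (fmul f X) = (\<lambda>p. f p * e X p)"
proof -
  have lin: "linear_on_set (tangent_space A p) (\<eta> p)" for p
    using eta by (simp add: one_forms_def)
  show "e (X + Y) = (\<lambda>p. e X p + e Y p)" "e (fmul f X) = (\<lambda>p. f p * e X p)"
    using lin assms by (auto simp: app_def fmul_def linear_on_set_def)
  show "e (X - Y) = (\<lambda>p. e X p - e Y p)"
    using linear_on_set_diff[OF subspace_tangent_space lin] assms by (auto simp: app_def)
qed

lemma phi_VF [simp]: "X \<in> VF \<Longrightarrow> app \<phi> X \<in> VF"
  using phi by (simp add: endo_fields_def)

lemma phi_diff:
  assumes "X \<in> VF" "Y \<in> VF"
  shows "app \<phi> (X - Y) = app \<phi> X - app \<phi> Y"
proof -
  have lin: "linear_on_set (tangent_space A p) (\<phi> p)" for p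
    using phi by (simp add: endo_fields_def)
  show ?thesis
    using linear_on_set_diff[OF subspace_tangent_space lin] assms by (auto simp: app_def)
qed

lemma G_0_right [simp]: "X \<in> VF \<Longrightarrow> G X 0 = (\<lambda>p. 0)"
  using G_right(2)[of X 0 0] by simp

lemma G_xi [simp]:
  assumes "X \<in> VF"
  shows "G X \<xi> = (\<lambda>p. \<epsilon> * e X p)" and "G \<xi> X = (\<lambda>p. \<epsilon> * e X p)"
proof -
  have "G (app \<phi> X) (app \<phi> \<xi>) = G X \<xi> - \<epsilon> *\<^sub>R (e X * e \<xi>)" by (rule G_phi[OF assms xi])
  then have "G X \<xi> p - \<epsilon> * e X p = 0" for p
    using assms by (auto simp: phi_xi fun_eq_iff scaleR_fun_def)
  then show 1: "G X \<xi> = (\<lambda>p. \<epsilon> * e X p)" by auto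
  then show "G \<xi> X = (\<lambda>p. \<epsilon> * e X p)" using G_sym[OF xi assms] by simp
qed

subsection \<open>The connection\<close>

lemma connection_facts:
  assumes "X \<in> VF" "Y \<in> VF"
  shows D_VF [simp]: "D X Y \<in> VF"
    and D_add_left: "Z \<in> VF \<Longrightarrow> D (X + Z) Y = D X Y + D Z Y"
    and D_add: "Z \<in> VF \<Longrightarrow> D X (Y + Z) = D X Y + D X Z"
    and D_fmul_left: "f \<in> C \<Longrightarrow> D (fmul f X) Y = fmul f (D X Y)"
    and D_fmul: "f \<in> C \<Longrightarrow> D X (fmul f Y) = fmul (dd X f) Y + fmul f (D X Y)"
    and torsion_free: "br X Y = D X Y - D Y X"
    and dd_G: "Z \<in> VF \<Longrightarrow> dd Z (G X Y) = (\<lambda>p. G (D Z X) Y p + G X (D Z Y) p)"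
  using levi_civita assms
  by (auto simp: levi_civita_connection_def affine_connection_def plus_fun_def)

lemma D_0 [simp]: "X \<in> VF \<Longrightarrow> D X 0 = 0"
  using D_add[of X 0 0] by simp

lemma D_diff: 
  assumes "X \<in> VF" "Y \<in> VF" "Z \<in> VF"
  shows "D X (Y - Z) = D X Y - D X Z"
  using D_add[of X "Y - Z" Z] assms by simp

lemma D_diff_left: 
  assumes "X \<in> VF" "Y \<in> VF" "Z \<in> VF"
  shows "D (X - Y) Z = D X Z - D Y Z"
  using D_add_left[of "X - Y" Z Y] assms by simp

text \<open>
The Kenmotsu equation with \<open>Y = \<xi>\<close> says \<open>\<phi> (\<nabla>\<^sub>X \<xi> - X) = 0\<close>, so \<open>\<nabla>\<^sub>X \<xi> - X\<close> is a multiple of \<open>\<xi>\<close>. The factor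
is found from \<open>\<eta> (\<nabla>\<^sub>X \<xi>) = 0\<close>, which holds because \<open>g(\<xi>,\<xi>)\<close> is constant.
\<close>

lemma D_xi:
  assumes X: "X \<in> VF"
  shows "D X \<xi> = X - fmul (e X) \<xi>"
proof -
  let ?W = "D X \<xi> - X"
  have "cov_deriv_endo D \<phi> X \<xi> = - app \<phi> (D X \<xi>)"
    using X by (simp add: cov_deriv_endo_def phi_xi)
  moreover have "fmul (\<epsilon> *\<^sub>R G X (app \<phi> \<xi>)) \<xi> = 0" "fmul (e \<xi>) (app \<phi> X) = app \<phi> X"
    using X by (auto simp: phi_xi fmul_def fun_eq_iff scaleR_fun_def)
  ultimately have "app \<phi> (D X \<xi>) = app \<phi> X"
    using nabla_phi[OF X xi] by simp
  then have "app \<phi> ?W = 0" using X by (simp add: phi_diff)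
  moreover have "app \<phi> 0 = 0" using phi_diff[of 0 0] by simp
  ultimately have "- ?W + fmul (e ?W) \<xi> = 0" using phi_phi[of ?W] X by simp
  moreover have "e (D X \<xi>) p = 0" for p
  proof -
    have "dd X (G \<xi> \<xi>) p = G (D X \<xi>) \<xi> p + G \<xi> (D X \<xi>) p"
      by (rule fun_cong[OF dd_G[OF xi xi X]])
    then have "2 * (\<epsilon> * e (D X \<xi>) p) = 0" using X by simp
    then show ?thesis using eps by auto
  qed
  then have "fmul (e ?W) \<xi> = - fmul (e X) \<xi>"
    using X by (simp add: fmul_def fun_eq_iff)
  ultimately have "- (D X \<xi> - X) - fmul (e X) \<xi> = 0" by simp
  then show ?thesis by (simp add: algebra_simps)
qed

lemma dd_e:
  assumes "X \<in> VF" "Y \<in> VF"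
  shows "dd X (e Y) = (\<lambda>p. e (D X Y) p + \<epsilon> * G X Y p - e X p * e Y p)"
proof
  fix p
  have "dd X (\<lambda>p. \<epsilon> * e Y p) p = \<epsilon> * e (D X Y) p + G Y (D X \<xi>) p"
    using dd_G[of Y \<xi> X] assms by simp
  moreover have "dd X (\<lambda>p. \<epsilon> * e Y p) p = \<epsilon> * dd X (e Y) p" using assms by simp
  ultimately have "\<epsilon> * dd X (e Y) p = \<epsilon> * e (D X Y) p + G X Y p - e X p * (\<epsilon> * e Y p)"
    using assms by (simp add: D_xi G_sym[of Y X])
  then have "\<epsilon> * (\<epsilon> * dd X (e Y) p) = \<epsilon> * (\<epsilon> * e (D X Y) p + G X Y p - e X p * (\<epsilon> * e Y p))"
    by simp
  then show "dd X (e Y) p = e (D X Y) p + \<epsilon> * G X Y p - e X p * e Y p"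
    by (simp add: algebra_simps)
qed

lemma e_closed:
  assumes "X \<in> VF" "Y \<in> VF"
  shows "e (br X Y) = (\<lambda>p. dd X (e Y) p - dd Y (e X) p)"
  using assms by (simp add: torsion_free dd_e G_sym[of X Y])

lemma br_xi: "X \<in> VF \<Longrightarrow> br \<xi> X = D \<xi> X - X + fmul (e X) \<xi>"
  by (simp add: torsion_free D_xi)

lemma dd_xi_e: "X \<in> VF \<Longrightarrow> dd \<xi> (e X) = e (br \<xi> X)"
  by (simp add: e_closed)

text \<open>
The part of the metric on the orthogonal complement of \<open>\<xi>\<close>. In the local warped product
\<open>\<epsilon> dt\<^sup>2 + e\<^bsup>2t\<^esup> h\<close> it is \<open>e\<^bsup>2t\<^esup> h\<close>.
\<close>

definition H :: "'a vfield \<Rightarrow> 'a vfield \<Rightarrow> 'a \<Rightarrow> real" where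
  "H X Y = (\<lambda>p. G X Y p - \<epsilon> * (e X p * e Y p))"

lemma H_C [simp]: "X \<in> VF \<Longrightarrow> Y \<in> VF \<Longrightarrow> H X Y \<in> C"
  by (simp add: H_def)

lemma H_sym: "X \<in> VF \<Longrightarrow> Y \<in> VF \<Longrightarrow> H X Y = H Y X"
  by (simp add: H_def G_sym[of X Y] mult.commute)

lemma dd_xi_G:
  assumes "X \<in> VF" "Y \<in> VF"
  shows "dd \<xi> (G X Y) = (\<lambda>p. G (br \<xi> X) Y p + G X (br \<xi> Y) p + 2 * H X Y p)"
  using assms by (simp add: br_xi dd_G H_def algebra_simps)

lemma dd_H:
  assumes "X \<in> VF" "Y \<in> VF" "Z \<in> VF"
  shows "dd X (H Y Z) p = H (D X Y) Z p + H Y (D X Z) p - (H X Y p * e Z p + e Y p * H X Z p)"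
  using assms by (simp add: H_def dd_G dd_e algebra_simps)

text \<open>
The Lie derivative of the connection along \<open>\<xi>\<close>, a tensor although the connection is none.
\<close>

definition Lie_xi_D :: "'a vfield \<Rightarrow> 'a vfield \<Rightarrow> 'a vfield" where
  "Lie_xi_D X Y = br \<xi> (D X Y) - D (br \<xi> X) Y - D X (br \<xi> Y)"

lemma Lie_xi_D_VF [simp]: "X \<in> VF \<Longrightarrow> Y \<in> VF \<Longrightarrow> Lie_xi_D X Y \<in> VF"
  by (simp add: Lie_xi_D_def)

lemma Lie_xi_D_sym:
  assumes "X \<in> VF" "Y \<in> VF"
  shows "Lie_xi_D X Y = Lie_xi_D Y X"
proof -
  have "br \<xi> (D X Y) - br \<xi> (D Y X) = br \<xi> (br X Y)"
    unfolding torsion_free[OF assms] using assms by (intro br_diff[symmetric]) simp_all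
  also have "\<dots> = br (br \<xi> X) Y + br X (br \<xi> Y)" using assms by (intro br_jacobi) simp_all
  also have "\<dots> = D (br \<xi> X) Y - D Y (br \<xi> X) + (D X (br \<xi> Y) - D (br \<xi> Y) X)"
    using assms torsion_free[of "br \<xi> X" Y] torsion_free[of X "br \<xi> Y"] by simp
  finally show ?thesis by (simp add: Lie_xi_D_def algebra_simps)
qed

text \<open>
Metric compatibility \<open>X g(Y,Z) = g(\<nabla>\<^sub>X Y, Z) + g(Y, \<nabla>\<^sub>X Z)\<close> is differentiated along \<open>\<xi>\<close>. Since \<open>\<pounds>\<^sub>\<xi> g = 2 H\<close>,
what remains on the right is \<open>2 (\<nabla>\<^sub>X H)(Y,Z)\<close>.
\<close>

lemma G_Lie_xi_D:
  assumes "X \<in> VF" "Y \<in> VF" "Z \<in> VF"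
  shows "G (Lie_xi_D X Y) Z p + G Y (Lie_xi_D X Z) p = - 2 * (H X Y p * e Z p + e Y p * H X Z p)"
proof -
  have "dd (br \<xi> X) (G Y Z) p = dd \<xi> (dd X (G Y Z)) p - dd X (dd \<xi> (G Y Z)) p"
    using assms by (simp add: dd_br)
  moreover have "dd (br \<xi> X) (G Y Z) p = G (D (br \<xi> X) Y) Z p + G Y (D (br \<xi> X) Z) p"
    using assms by (simp add: dd_G)
  moreover have "dd \<xi> (dd X (G Y Z)) p =
      G (br \<xi> (D X Y)) Z p + G (D X Y) (br \<xi> Z) p + 2 * H (D X Y) Z p
      + G (br \<xi> Y) (D X Z) p + G Y (br \<xi> (D X Z)) p + 2 * H Y (D X Z) p"
    using assms by (simp add: dd_G[of Y Z X] dd_xi_G)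
  moreover have "dd X (dd \<xi> (G Y Z)) p =
      G (D X (br \<xi> Y)) Z p + G (br \<xi> Y) (D X Z) p
      + G (D X Y) (br \<xi> Z) p + G Y (D X (br \<xi> Z)) p + 2 * dd X (H Y Z) p"
    using assms by (simp add: dd_xi_G) (simp add: dd_G)
  ultimately show ?thesis
    using assms dd_H[OF assms, of p] by (simp add: Lie_xi_D_def)
qed

text \<open>
As in the uniqueness proof for the Levi-Civita connection: the difference of the two sides, paired
with \<open>Z\<close>, is a trilinear form that is symmetric in the first two and skew in the last two arguments,
and such a form vanishes.
\<close>

lemma Lie_xi_D_eq:
  assumes "X \<in> VF" "Y \<in> VF"
  shows "Lie_xi_D X Y = fmul (\<lambda>p. - 2 * \<epsilon> * H X Y p) \<xi>"
proof (rule G_nondegenerate)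
  let ?T = "\<lambda>X Y Z p. G (Lie_xi_D X Y) Z p + 2 * (H X Y p * e Z p)"
  have sym: "?T X Y Z p = ?T Y X Z p" if "X \<in> VF" "Y \<in> VF" for X Y Z p
    using that Lie_xi_D_sym H_sym by simp
  have skew: "?T X Y Z p = - ?T X Z Y p" if "X \<in> VF" "Y \<in> VF" "Z \<in> VF" for X Y Z p
    using G_Lie_xi_D[OF that, of p] G_sym[of Y "Lie_xi_D X Z"] that by (simp add: algebra_simps)
  fix Z p assume Z: "Z \<in> VF"
  have "?T X Y Z p = - ?T X Z Y p" using skew assms Z by blast
  also have "\<dots> = - ?T Z X Y p" using sym assms Z by simp
  also have "\<dots> = ?T Z Y X p" using skew[of Z X Y p] assms Z by simp
  also have "\<dots> = ?T Y Z X p" using sym assms Z by simp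
  also have "\<dots> = - ?T Y X Z p" using skew[of Y Z X p] assms Z by simp
  also have "\<dots> = - ?T X Y Z p" using sym assms by simp
  finally show "G (Lie_xi_D X Y) Z p = G (fmul (\<lambda>p. - 2 * \<epsilon> * H X Y p) \<xi>) Z p"
    using assms Z by (simp add: algebra_simps)
qed (use assms in simp_all)

lemma br_xi_D:
  assumes "X \<in> VF" "Y \<in> VF"
  shows "br \<xi> (D X Y) = D (br \<xi> X) Y + D X (br \<xi> Y) + fmul (\<lambda>p. - 2 * \<epsilon> * H X Y p) \<xi>"
  using Lie_xi_D_eq[OF assms] by (simp add: Lie_xi_D_def algebra_simps)

subsection \<open>Curvature\<close>

lemma R_VF [simp]: "X \<in> VF \<Longrightarrow> Y \<in> VF \<Longrightarrow> Z \<in> VF \<Longrightarrow> R X Y Z \<in> VF"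
  by (simp add: curvature_def)

lemma R_add: 
  "X \<in> VF \<Longrightarrow> X' \<in> VF \<Longrightarrow> Y \<in> VF \<Longrightarrow> Z \<in> VF \<Longrightarrow> R (X + X') Y Z = R X Y Z + R X' Y Z"
  by (simp add: curvature_def D_add_left D_add br_add_left algebra_simps)

lemma R_fmul:
  "f \<in> C \<Longrightarrow> X \<in> VF \<Longrightarrow> Y \<in> VF \<Longrightarrow> Z \<in> VF \<Longrightarrow> R (fmul f X) Y Z = fmul f (R X Y Z)"
  by (simp add: curvature_def D_fmul_left D_fmul D_diff_left br_fmul_left)
    (simp add: fun_eq_iff fmul_def scaleR_fun_def algebra_simps)

lemma R_xi:
  assumes "X \<in> VF" "Y \<in> VF"
  shows "R X Y \<xi> = fmul (e X) Y - fmul (e Y) X"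
  using assms
  by (simp add: curvature_def D_xi D_diff D_fmul e_closed)
    (simp add: torsion_free fun_eq_iff fmul_def scaleR_fun_def algebra_simps)

text \<open>
With \<open>k = \<pounds>\<^sub>\<xi> \<nabla>\<close> one has \<open>(\<pounds>\<^sub>\<xi> R)(X,Y)Z = (\<nabla>\<^sub>X k)(Y,Z) - (\<nabla>\<^sub>Y k)(X,Z)\<close>. Here \<open>k = -2 \<epsilon> H \<otimes> \<xi>\<close>, and the \<open>\<xi>\<close>-components
that come from \<open>\<nabla>H\<close> and from \<open>\<nabla>\<xi>\<close> cancel, so that \<open>-2 \<epsilon> (H(Y,Z) X - H(X,Z) Y)\<close> is left.
\<close>

lemma Lie_R:
  assumes "X \<in> VF" "Y \<in> VF" "Z \<in> VF"
  shows "br \<xi> (R X Y Z) = R (br \<xi> X) Y Z + R X (br \<xi> Y) Z + R X Y (br \<xi> Z)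
    - fmul (\<lambda>p. 2 * \<epsilon> * H Y Z p) X + fmul (\<lambda>p. 2 * \<epsilon> * H X Z p) Y"
proof -
  have DD: "br \<xi> (D X (D Y Z)) = D (br \<xi> X) (D Y Z) + D X (D (br \<xi> Y) Z) + D X (D Y (br \<xi> Z))
      + (fmul (\<lambda>p. - 2 * \<epsilon> * dd X (H Y Z) p) \<xi> + fmul (\<lambda>p. - 2 * \<epsilon> * H Y Z p) (X - fmul (e X) \<xi>))
      + fmul (\<lambda>p. - 2 * \<epsilon> * H X (D Y Z) p) \<xi>" if "X \<in> VF" "Y \<in> VF" for X Y
    using that assms(3) by (simp add: br_xi_D D_add D_fmul D_xi)
  have "br \<xi> (br X Y) = br (br \<xi> X) Y + br X (br \<xi> Y)" using assms by (intro br_jacobi) simp_all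
  then have Dbr: "br \<xi> (D (br X Y) Z) = D (br (br \<xi> X) Y) Z + D (br X (br \<xi> Y)) Z
      + D (br X Y) (br \<xi> Z) + fmul (\<lambda>p. - 2 * \<epsilon> * H (br X Y) Z p) \<xi>"
    using assms by (simp add: br_xi_D D_add_left)
  have H: "dd X (H Y Z) p + H X (D Y Z) p - dd Y (H X Z) p - H Y (D X Z) p - H (br X Y) Z p
      = e X p * H Y Z p - e Y p * H X Z p" for p
  proof -
    have "H (br X Y) Z p = H (D X Y) Z p - H (D Y X) Z p"
      using assms by (simp add: torsion_free H_def algebra_simps)
    moreover have "H X Y p = H Y X p" "H X (D Y Z) p = H (D Y Z) X p" using H_sym assms by simp_all
    ultimately show ?thesis
      using dd_H[OF assms, of p] dd_H[of Y X Z p] H_sym[of X "D Y Z"] assms by (simp add: algebra_simps)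
  qed
  show ?thesis
  proof (intro ext)
    fix p f
    have "br \<xi> (R X Y Z) p f = br \<xi> (D X (D Y Z)) p f - br \<xi> (D Y (D X Z)) p f - br \<xi> (D (br X Y) Z) p f"
      using assms by (simp add: curvature_def br_diff)
    also have "\<dots> = (R (br \<xi> X) Y Z + R X (br \<xi> Y) Z + R X Y (br \<xi> Z)) p f
      - 2 * \<epsilon> * (dd X (H Y Z) p + H X (D Y Z) p - dd Y (H X Z) p - H Y (D X Z) p - H (br X Y) Z p) * \<xi> p f
      - 2 * \<epsilon> * H Y Z p * (X p f - e X p * \<xi> p f) + 2 * \<epsilon> * H X Z p * (Y p f - e Y p * \<xi> p f)"
      unfolding DD[OF assms(1,2)] DD[OF assms(2,1)] Dbr
      by (simp add: curvature_def fmul_def scaleR_fun_def algebra_simps)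
    also have "\<dots> = (R (br \<xi> X) Y Z + R X (br \<xi> Y) Z + R X Y (br \<xi> Z)
      - fmul (\<lambda>p. 2 * \<epsilon> * H Y Z p) X + fmul (\<lambda>p. 2 * \<epsilon> * H X Z p) Y) p f"
      unfolding H by (simp add: fmul_def scaleR_fun_def algebra_simps)
    finally show "br \<xi> (R X Y Z) p f = \<dots>" .
  qed
qed

subsection \<open>Ricci curvature\<close>

lemma linear_apply_at: "linear (\<lambda>v :: 'a tangent. v f)"
  by (rule linearI) (simp_all add: scaleR_fun_def)

lemma R_at_frame:
  assumes "frame_on N E u" "X \<in> VF" "Y \<in> VF" "Z \<in> VF" "q \<in> N"
  shows "R X Y Z q = (\<Sum>b\<in>Basis. X q (u b) *\<^sub>R R (E b) Y Z q)"
  by (rule tensor_local_frame[OF assms(1) _ _ assms(2,5), of "\<lambda>X. R X Y Z"])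
    (simp_all add: R_add R_fmul assms)

lemma ricci_frame:
  assumes fr: "frame_on N E u" and YZ: "Y \<in> VF" "Z \<in> VF" and q: "q \<in> N"
  shows "ricci A D Y Z q = (\<Sum>b\<in>Basis. dd (R (E b) Y Z) (u b) q)"
proof -
  note frD = frame_onD[OF fr]
  have "ricci A D Y Z q = (\<Sum>b\<in>Basis. (\<lambda>v. v (u b)) (R (E b) Y Z q))"
    unfolding ricci_def
  proof (rule trace_on_frame[where \<kappa> = "\<lambda>b v. v (u b)" and E = "\<lambda>b. E b q",
        OF subspace_tangent_space finite_Basis linear_apply_at])
    show "R (E b) Y Z q \<in> tangent_space A q" if "b \<in> Basis" for b
      using YZ frD(2)[OF that] by simp
    show "v = (\<Sum>b\<in>Basis. v (u b) *\<^sub>R E b q)" if "v \<in> tangent_space A q" for v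
      by (rule frD(5)[OF q that])
    show "R (SOME X. X \<in> VF \<and> X q = v) Y Z q = (\<Sum>b\<in>Basis. v (u b) *\<^sub>R R (E b) Y Z q)"
      if "v \<in> tangent_space A q" for v
    proof -
      have "\<exists>X. X \<in> VF \<and> X q = v" using vector_field_through[OF that] by blast
      from someI_ex[OF this] show ?thesis
        using R_at_frame[OF fr _ YZ q, of "SOME X. X \<in> VF \<and> X q = v"] by simp
    qed
  qed
  then show ?thesis by (simp add: dir_deriv_def)
qed

text \<open>
The trace of the rank one map \<open>v \<mapsto> F(v) Y\<close> is \<open>F(Y)\<close>.
\<close>

lemma trace_identity_rank_one:
  assumes fr: "frame_on N E u" and Y: "Y \<in> VF" and q: "q \<in> N"
    and F: "linear_on_set (tangent_space A q) F"
  shows "(\<Sum>b\<in>Basis. F (E b q) * dd Y (u b) q) = (F (Y q) :: real)"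
proof -
  have "F (Y q) = F (\<Sum>b\<in>Basis. Y q (u b) *\<^sub>R E b q)"
    using frame_onD(5)[OF fr q VF_tangent[OF Y, of q]] by simp
  also have "\<dots> = (\<Sum>b\<in>Basis. Y q (u b) *\<^sub>R F (E b q))"
    using frame_onD(2)[OF fr]
    by (intro linear_on_set_sum[OF subspace_tangent_space F finite_Basis]) simp
  finally show ?thesis by (simp add: dir_deriv_def mult.commute)
qed

lemma trace_identity:
  assumes fr: "frame_on N E u" and q: "q \<in> N"
  shows "(\<Sum>b\<in>Basis. f * dd (E b) (u b) q) = real DIM('e) * f"
  using frame_onD(4)[OF fr q] by (simp add: dir_deriv_def)

lemma ricci_xi:
  assumes "Y \<in> VF"
  shows "ricci A D Y \<xi> p = (1 - real DIM('e)) * e Y p"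
proof -
  obtain N E u where p: "p \<in> N" and fr: "frame_on N E u" by (rule local_frame)
  have lin: "linear_on_set (tangent_space A p) (\<eta> p)"
    using eta by (simp add: one_forms_def)
  have "ricci A D Y \<xi> p = (\<Sum>b\<in>Basis. \<eta> p (E b p) * dd Y (u b) p - e Y p * dd (E b) (u b) p)"
    unfolding ricci_frame[OF fr assms xi p]
    using frame_onD(2)[OF fr] by (simp add: R_xi assms) (simp add: app_def)
  then show ?thesis
    using trace_identity_rank_one[OF fr assms p lin] trace_identity[OF fr p, of "e Y p"]
    by (simp add: sum_subtractf app_def algebra_simps)
qed

text \<open>
Taking a trace commutes with the Lie derivative: the contribution of \<open>[\<xi>, E\<^sub>b]\<close> cancels that of
\<open>\<xi>(u\<^sub>b)\<close>, because \<open>E\<^sub>b(u\<^sub>c)\<close> is locally constant. Hence the Lie derivative of \<open>Ric\<close> is the trace of the tensor in \<open>Lie_R\<close>, which is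
\<open>-2 \<epsilon> (m H(Y,Z) - H(Y,Z))\<close> in dimension \<open>m\<close>.
\<close>

lemma Lie_ricci:
  assumes YZ: "Y \<in> VF" "Z \<in> VF" and ric: "ricci A D Y Z \<in> C"
  shows "Lie (ricci A D) \<xi> Y Z p = 2 * \<epsilon> * (1 - real DIM('e)) * H Y Z p"
proof -
  obtain N E u where p: "p \<in> N" and fr: "frame_on N E u" by (rule local_frame)
  note frD = frame_onD[OF fr]
  let ?R = "\<lambda>b. R (E b) Y Z"
  have R: "?R b \<in> VF" if "b \<in> Basis" for b using frD(2)[OF that] YZ by simp
  have "dd \<xi> (ricci A D Y Z) p = dd \<xi> (\<Sum>b\<in>Basis. dd (?R b) (u b)) p"
    unfolding dir_deriv_def[of \<xi>]
  proof (rule tangent_local[OF VF_tangent[OF xi] frD(1) p ric])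
    show "(\<Sum>b\<in>Basis. dd (?R b) (u b)) \<in> C" using R frD(3) by (intro C_sum) simp
    show "ricci A D Y Z q = (\<Sum>b\<in>Basis. dd (?R b) (u b)) q" if "q \<in> N" for q
      by (simp only: ricci_frame[OF fr YZ that] sum_fun_apply)
  qed
  also have "\<dots> = (\<Sum>b\<in>Basis. dd \<xi> (dd (?R b) (u b)) p)"
    unfolding dir_deriv_def[of \<xi>] using R frD(3)
    by (intro tangent_sum[OF VF_tangent[OF xi]]) simp
  also have "\<dots> = (\<Sum>b\<in>Basis. dd (R (br \<xi> (E b)) Y Z) (u b) p + dd (?R b) (dd \<xi> (u b)) p
      + (dd (R (E b) (br \<xi> Y) Z) (u b) p + dd (R (E b) Y (br \<xi> Z)) (u b) p)
      - (2 * \<epsilon> * H Y Z p) * dd (E b) (u b) p + 2 * \<epsilon> * (H (E b) Z p * dd Y (u b) p))"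
  proof (rule sum.cong[OF refl])
    fix b :: 'e assume b: "b \<in> Basis"
    have "dd \<xi> (dd (?R b) (u b)) p = dd (br \<xi> (?R b)) (u b) p + dd (?R b) (dd \<xi> (u b)) p"
      using dd_br[OF frD(3)[OF b]] by simp
    then show "dd \<xi> (dd (?R b) (u b)) p = dd (R (br \<xi> (E b)) Y Z) (u b) p + dd (?R b) (dd \<xi> (u b)) p
      + (dd (R (E b) (br \<xi> Y) Z) (u b) p + dd (R (E b) Y (br \<xi> Z)) (u b) p)
      - (2 * \<epsilon> * H Y Z p) * dd (E b) (u b) p + 2 * \<epsilon> * (H (E b) Z p * dd Y (u b) p)"
      unfolding Lie_R[OF frD(2)[OF b] YZ] by simp
  qed
  also have "\<dots> = (\<Sum>b\<in>Basis. dd (R (br \<xi> (E b)) Y Z) (u b) p)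
      + (\<Sum>b\<in>Basis. dd (?R b) (dd \<xi> (u b)) p)
      + ((\<Sum>b\<in>Basis. dd (R (E b) (br \<xi> Y) Z) (u b) p) + (\<Sum>b\<in>Basis. dd (R (E b) Y (br \<xi> Z)) (u b) p))
      - (\<Sum>b\<in>Basis. (2 * \<epsilon> * H Y Z p) * dd (E b) (u b) p)
      + 2 * \<epsilon> * (\<Sum>b\<in>Basis. H (E b) Z p * dd Y (u b) p)"
    by (simp only: sum.distrib sum_subtractf sum_distrib_left)
  finally have main: "dd \<xi> (ricci A D Y Z) p = \<dots>" .
  \<comment> \<open>Both sums are \<open>\<Sum>\<^sub>b\<^sub>c E\<^sub>b(\<xi> u\<^sub>c) R(E\<^sub>c,Y)Z(u\<^sub>b)\<close> up to sign.\<close>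
  have cancel: "(\<Sum>b\<in>Basis. dd (R (br \<xi> (E b)) Y Z) (u b) p) = - (\<Sum>b\<in>Basis. dd (?R b) (dd \<xi> (u b)) p)"
  proof -
    have E_const: "dd \<xi> (dd (E b) (u c)) p = 0" if "b \<in> Basis" "c \<in> Basis" for b c
    proof -
      have "dd \<xi> (dd (E b) (u c)) p = dd \<xi> (\<lambda>_. if b = c then 1 else 0) p"
        unfolding dir_deriv_def[of \<xi>]
      proof (rule tangent_local[OF VF_tangent[OF xi] frD(1) p])
        show "dd (E b) (u c) \<in> C" by (rule dd_C[OF frD(2)[OF that(1)] frD(3)[OF that(2)]])
        show "dd (E b) (u c) q = (if b = c then 1 else 0)" if "q \<in> N" for q
          unfolding dir_deriv_def by (rule frD(4)) fact+
      qed (rule C_const)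
      then show ?thesis by simp
    qed
    have "(\<Sum>b\<in>Basis. dd (R (br \<xi> (E b)) Y Z) (u b) p)
        = (\<Sum>b\<in>Basis. \<Sum>c\<in>Basis. - dd (E b) (dd \<xi> (u c)) p * dd (?R c) (u b) p)"
    proof (rule sum.cong[OF refl])
      fix b :: 'e assume b: "b \<in> Basis"
      have "R (br \<xi> (E b)) Y Z p = (\<Sum>c\<in>Basis. br \<xi> (E b) p (u c) *\<^sub>R ?R c p)"
        using frD(2)[OF b] by (intro R_at_frame[OF fr _ YZ p]) simp
      moreover have "br \<xi> (E b) p (u c) = - dd (E b) (dd \<xi> (u c)) p" if "c \<in> Basis" for c
        using fun_cong[OF dd_br[OF frD(3)[OF that]], of \<xi> "E b" p] E_const[OF b that]
        by (simp add: dir_deriv_def[of "br \<xi> (E b)"])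
      ultimately show "dd (R (br \<xi> (E b)) Y Z) (u b) p
          = (\<Sum>c\<in>Basis. - dd (E b) (dd \<xi> (u c)) p * dd (?R c) (u b) p)"
        by (simp add: dir_deriv_def[of "R _ _ _"] sum_fun_apply scaleR_fun_def)
    qed
    also have "\<dots> = (\<Sum>c\<in>Basis. \<Sum>b\<in>Basis. - dd (E b) (dd \<xi> (u c)) p * dd (?R c) (u b) p)"
      by (rule sum.swap)
    also have "\<dots> = (\<Sum>c\<in>Basis. - dd (?R c) (dd \<xi> (u c)) p)"
    proof (rule sum.cong[OF refl])
      fix c :: 'e assume c: "c \<in> Basis"
      have "?R c p (dd \<xi> (u c)) = (\<Sum>b\<in>Basis. ?R c p (u b) *\<^sub>R E b p) (dd \<xi> (u c))"
        by (rule fun_cong[OF frD(5)[OF p VF_tangent[OF R[OF c]]]])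
      then show "(\<Sum>b\<in>Basis. - dd (E b) (dd \<xi> (u c)) p * dd (?R c) (u b) p) = - dd (?R c) (dd \<xi> (u c)) p"
        by (simp add: dir_deriv_def[of "R _ _ _"] dir_deriv_def[of "E _"] sum_fun_apply scaleR_fun_def
            sum_negf mult.commute)
    qed
    finally show ?thesis by (simp add: sum_negf)
  qed
  have tr_H: "(\<Sum>b\<in>Basis. H (E b) Z p * dd Y (u b) p) = H Y Z p"
  proof -
    have lin: "linear_on_set (tangent_space A p) (\<lambda>v. g p (Z p) v - \<epsilon> * (\<eta> p v * e Z p))"
      using G_linear_at[OF VF_tangent[OF YZ(2)]] eta
      by (simp add: one_forms_def linear_on_set_def algebra_simps)
    have "H X Z p = g p (Z p) (X p) - \<epsilon> * (\<eta> p (X p) * e Z p)" if "X \<in> VF" for X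
      using G_sym[OF that YZ(2)] by (simp add: H_def app2_def[of g Z] app_def[of \<eta> X])
    then show ?thesis
      using trace_identity_rank_one[OF fr YZ(1) p lin] frD(2) YZ by simp
  qed
  show ?thesis
    unfolding Lie_def main cancel tr_H trace_identity[OF fr p]
    using YZ by (simp add: ricci_frame[OF fr _ _ p] algebra_simps)
qed

subsection \<open>Ricci solitons\<close>

text \<open>
If \<open>H\<close> were zero, every field would be a multiple of \<open>\<xi>\<close>, and then two frame fields could not be
linearly independent.
\<close>

lemma H_not_zero:
  assumes "DIM('e) \<ge> 2"
  obtains X Y p where "X \<in> VF" "Y \<in> VF" "H X Y p \<noteq> 0"
proof (rule ccontr)
  assume "\<not> thesis"
  with that have H0: "H X Y p = 0" if "X \<in> VF" "Y \<in> VF" for X Y p using that by blast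
  obtain p :: 'a where True by blast
  obtain N E u where p: "p \<in> N" and fr: "frame_on N E u" by (rule local_frame)
  note frD = frame_onD[OF fr]
  have X: "X = fmul (e X) \<xi>" if "X \<in> VF" for X
    by (rule G_nondegenerate) (use H0 that in \<open>simp_all add: H_def algebra_simps\<close>)
  have Eu: "E b p (u c) = e (E b) p * \<xi> p (u c)" if "b \<in> Basis" for b c
    using fun_cong[OF fun_cong[OF X[OF frD(2)[OF that]]], of p "u c"] by (simp add: fmul_def scaleR_fun_def)
  have "\<not> (\<exists>b::'e. Basis = {b})" using assms by (metis One_nat_def card.empty card.insert empty_iff finite.emptyI not_less_eq_eq numeral_2_eq_2 order_refl)
  then obtain b c :: 'e where bc: "b \<in> Basis" "c \<in> Basis" "b \<noteq> c"
    using nonempty_Basis by blast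
  have "e (E b) p * \<xi> p (u b) = 1" "e (E b) p * \<xi> p (u c) = 0" "e (E c) p * \<xi> p (u c) = 1"
    using frD(4)[OF p] bc Eu by (metis (full_types))+
  then show False by auto
qed

text \<open>
As \<open>\<eta>\<close> is closed, \<open>\<pounds>\<^sub>W \<eta> = d(\<eta>(W))\<close>.
\<close>

lemma H_lie:
  assumes "W \<in> VF" "X \<in> VF" "Y \<in> VF"
  shows "Lie H W X Y p = Lie G W X Y p - \<epsilon> * (dd X (e W) p * e Y p + e X p * dd Y (e W) p)"
  using assms by (simp add: Lie_def H_def e_closed algebra_simps)

lemma soliton_constant:
  assumes sol: "ricci_soliton A D g V l" and dim: "DIM('e) \<ge> 2"
  shows "l = (real DIM('e) - 1) * \<epsilon>"
proof -
  define m where "m = real DIM('e)"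
  define c where "c = (m - 1) * \<epsilon> - l"
  define Ric where "Ric = ricci A D"
  define P where "P = Lie G V"
  define U where "U = br \<xi> V"
  define f where "f = e V"
  have V [simp]: "V \<in> VF" using sol by (simp add: ricci_soliton_def)
  have U [simp]: "U \<in> VF" and f [simp]: "f \<in> C" by (simp_all add: U_def f_def)
  have P_C [simp]: "P X Y \<in> C" if "X \<in> VF" "Y \<in> VF" for X Y
    using that by (simp add: P_def Lie_def)
  have P: "P X Y p = - 2 * Ric X Y p - 2 * l * G X Y p" if "X \<in> VF" "Y \<in> VF" for X Y p
  proof -
    have "lie_deriv_metric A V g X Y + 2 *\<^sub>R ricci A D X Y + (2 * l) *\<^sub>R G X Y = 0"
      using sol that by (simp add: ricci_soliton_def)
    from fun_cong[OF this, of p] show ?thesis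
      by (simp add: lie_deriv_metric_def P_def Lie_def Ric_def scaleR_fun_def)
  qed
  have Ric_eq: "Ric X Y = (\<lambda>p. - (1 / 2) * P X Y p - l * G X Y p)" if "X \<in> VF" "Y \<in> VF" for X Y
    by (rule ext) (simp add: P[OF that] field_simps)
  have Ric_C: "Ric X Y \<in> C" if "X \<in> VF" "Y \<in> VF" for X Y
    unfolding Ric_eq[OF that] by (intro C_pointwise P_C G_C that)
  have Lie_G_xi: "Lie G \<xi> X Y = (\<lambda>p. 2 * H X Y p)" if "X \<in> VF" "Y \<in> VF" for X Y
    using that by (simp add: Lie_def dd_xi_G)
  \<comment> \<open>Here \<open>P\<close> is read as \<open>-2 Ric - 2 l g\<close>; this is where \<open>Lie_ricci\<close> enters.\<close>
  have Lie_P: "Lie P \<xi> X Y p = 4 * c * H X Y p" if XY: "X \<in> VF" "Y \<in> VF" for X Y p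
  proof -
    have "Lie P \<xi> X Y p = Lie (\<lambda>X Y p. - 2 * Ric X Y p - 2 * l * G X Y p) \<xi> X Y p"
      by (rule fun_cong[OF Lie_cong]) (use XY P in auto)
    also have "\<dots> = - 2 * Lie Ric \<xi> X Y p - 2 * l * Lie G \<xi> X Y p"
      using XY Ric_C by (simp add: Lie_def algebra_simps)
    also have "\<dots> = 4 * c * H X Y p"
      using Lie_ricci[of X Y p] Ric_C XY Lie_G_xi[OF XY]
      by (simp add: Ric_def c_def m_def algebra_simps)
    finally show ?thesis .
  qed
  \<comment> \<open>The two ways of computing \<open>P X \<xi>\<close>: from the Ricci tensor, and as a Lie derivative.\<close>
  have G_U: "G X U = (\<lambda>p. 2 * \<epsilon> * c * e X p - \<epsilon> * dd X f p)" if X: "X \<in> VF" for X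
  proof
    fix p
    have "P X \<xi> p = 2 * \<epsilon> * c * e X p"
      using P[OF X xi, of p] ricci_xi[OF X, of p] X eps
      by (auto simp: Ric_def c_def m_def algebra_simps)
    moreover have "P X \<xi> p = \<epsilon> * dd X f p + G X U p"
    proof -
      have "br V \<xi> = - U" unfolding U_def using br_minus_swap[OF V xi] by simp
      moreover have "G X (- U) = (\<lambda>p. - G X U p)" using G_right(2)[OF X VF_0 U] X by simp
      ultimately show ?thesis using X by (simp add: P_def Lie_def e_closed f_def algebra_simps)
    qed
    ultimately show "G X U p = 2 * \<epsilon> * c * e X p - \<epsilon> * dd X f p" by simp
  qed
  have e_U: "e U = (\<lambda>p. c)" and dd_f: "dd \<xi> f = (\<lambda>p. c)"
  proof -
    have 1: "e U = dd \<xi> f" by (simp add: U_def f_def e_closed)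
    have "\<epsilon> * e U p = 2 * \<epsilon> * c - \<epsilon> * dd \<xi> f p" for p
      using fun_cong[OF G_U[OF xi], of p] by simp
    then have "dd \<xi> f p = c" for p using eps unfolding 1 by (auto simp: algebra_simps)
    then show "dd \<xi> f = (\<lambda>p. c)" by auto
    then show "e U = (\<lambda>p. c)" using 1 by simp
  qed
  have dd_df: "dd \<xi> (dd X f) = dd (br \<xi> X) f" if "X \<in> VF" for X
    using that by (simp add: dd_br dd_f)
  \<comment> \<open>The formula for \<open>g(X,U)\<close> is differentiated along \<open>\<xi>\<close>; its right-hand side is \<open>\<pounds>\<^sub>\<xi>\<close>-invariant because \<open>\<xi> f\<close> is constant.\<close>
  have br_U: "br \<xi> U = fmul (\<lambda>_. 2 * c) \<xi> - fmul (\<lambda>_. 2) U"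
  proof (rule G_nondegenerate)
    fix X p assume X: "X \<in> VF"
    have "dd \<xi> (G X U) p = 2 * \<epsilon> * c * e (br \<xi> X) p - \<epsilon> * dd (br \<xi> X) f p"
      using X by (simp add: G_U dd_df dd_xi_e)
    moreover have "dd \<xi> (G X U) p = G (br \<xi> X) U p + G X (br \<xi> U) p + 2 * H X U p"
      using X by (simp add: dd_xi_G)
    ultimately have "G X (br \<xi> U) p = - 2 * G X U p + 2 * \<epsilon> * c * e X p"
      using X by (simp add: G_U[of "br \<xi> X"] H_def e_U algebra_simps)
    then show "G (br \<xi> U) X p = G (fmul (\<lambda>_. 2 * c) \<xi> - fmul (\<lambda>_. 2) U) X p"
      using X G_sym[of X "br \<xi> U"] G_sym[of X U] by (simp add: algebra_simps)
  qed simp_all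
  have Lie_U: "Lie G U X Y p = 4 * c * H X Y p - 2 * P X Y p + 2 * \<epsilon> * (dd X f p * e Y p + e X p * dd Y f p)"
    if XY: "X \<in> VF" "Y \<in> VF" for X Y p
  proof -
    have "Lie G U X Y p = Lie P \<xi> X Y p - Lie (Lie G \<xi>) V X Y p"
      unfolding U_def P_def by (rule Lie_bracket) (use XY in simp_all)
    also have "Lie (Lie G \<xi>) V X Y p = Lie (\<lambda>X Y p. 2 * H X Y p) V X Y p"
      by (rule fun_cong[OF Lie_cong]) (use XY Lie_G_xi in auto)
    also have "\<dots> = 2 * Lie H V X Y p"
      using XY by (simp add: Lie_def algebra_simps)
    finally show ?thesis
      using XY Lie_P[OF XY, of p] by (simp add: H_lie f_def P_def algebra_simps)
  qed
  have "c * H X Y p = 0" if XY: "X \<in> VF" "Y \<in> VF" for X Y p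
  proof -
    let ?q = "\<lambda>X Y p. 4 * c * H X Y p - 2 * P X Y p + 2 * \<epsilon> * (dd X f p * e Y p + e X p * dd Y f p)"
    \<comment> \<open>In \<open>\<pounds>\<^sub>\<xi> \<pounds>\<^sub>U g\<close> the terms \<open>8 c H\<close> cancel, and \<open>df\<close> and \<open>\<eta>\<close> are \<open>\<pounds>\<^sub>\<xi>\<close>-invariant.\<close>
    have "Lie (Lie G U) \<xi> X Y p = Lie ?q \<xi> X Y p"
      by (rule fun_cong[OF Lie_cong]) (use XY Lie_U in auto)
    also have "\<dots> = 4 * c * Lie H \<xi> X Y p - 2 * Lie P \<xi> X Y p"
      using XY by (simp add: Lie_def dd_df dd_xi_e algebra_simps)
    also have "\<dots> = 0"
      using XY by (simp add: H_lie Lie_P Lie_G_xi)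
    finally have 1: "Lie (Lie G U) \<xi> X Y p = 0" .
    have "Lie (Lie G \<xi>) U X Y p = Lie (\<lambda>X Y p. 2 * H X Y p) U X Y p"
      by (rule fun_cong[OF Lie_cong]) (use XY Lie_G_xi in auto)
    also have "\<dots> = 2 * Lie H U X Y p"
      using XY by (simp add: Lie_def algebra_simps)
    also have "\<dots> = 2 * Lie G U X Y p" using XY by (simp add: H_lie e_U)
    finally have 2: "Lie (Lie G \<xi>) U X Y p = 2 * Lie G U X Y p" .
    have br: "br (br \<xi> U) Z = fmul (\<lambda>_. 2 * c) (br \<xi> Z) - fmul (\<lambda>_. 2) (br U Z)" if "Z \<in> VF" for Z
      by (rule VF_eqI) (use that in \<open>simp_all add: br_U dd_br algebra_simps\<close>)
    have "Lie G (br \<xi> U) X Y p = 2 * c * Lie G \<xi> X Y p - 2 * Lie G U X Y p"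
      unfolding Lie_def br[OF XY(1)] br[OF XY(2)] unfolding br_U using XY by (simp add: algebra_simps)
    moreover have "Lie G (br \<xi> U) X Y p = Lie (Lie G U) \<xi> X Y p - Lie (Lie G \<xi>) U X Y p"
      by (rule Lie_bracket) (use XY in simp_all)
    ultimately show ?thesis using 1 2 Lie_G_xi[OF XY] by simp
  qed
  then have "c = 0" using H_not_zero[OF dim] by (metis mult_eq_0_iff)
  then show ?thesis by (simp add: c_def m_def)
qed

end

theorem theorem6:
  fixes A :: "('a::{t2_space, second_countable_topology}, 'e::euclidean_space) chart set"
    and \<phi> :: "'a endo_field" and \<xi> V :: "'a vfield" and \<eta> :: "'a one_form"
    and g :: "'a bilinear_field" and D :: "'a connection"
    and \<epsilon> l :: real and n :: nat
  assumes "smooth_atlas A"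
    and "n \<ge> 1" and "DIM('e) = 2 * n + 1"
    and "kenmotsu_pseudo_metric A D \<phi> \<xi> \<eta> g \<epsilon>"
    and "ricci_soliton A D g V l"
  shows "l = 2 * real n * \<epsilon> \<and>
    (\<epsilon> = 1 \<longrightarrow> expanding_ricci_soliton A D g V l) \<and>
    (\<epsilon> = -1 \<longrightarrow> shrinking_ricci_soliton A D g V l)"
proof -
  interpret kenmotsu_manifold A \<phi> \<xi> \<eta> g D \<epsilon>
    by unfold_locales (fact assms)+
  have "l = (real DIM('e) - 1) * \<epsilon>"
    using soliton_constant[OF assms(5)] assms(2,3) by simp
  then have "l = 2 * real n * \<epsilon>" using assms(3) by simp
  then show ?thesis
    using assms(2,5) by (auto simp: expanding_ricci_soliton_def shrinking_ricci_soliton_def)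
qed

end
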